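(* Let $v$ be an odd prime power (an odd prime or a power of one). Then there exists a balanced POTB for a $(v+1)^2$ experiment (that is, with two factors, each having $v+1$ levels) on $b=2v$ blocks of size $(v+1)/2$ each.
   Context: Let $b,k,m\ge 1$ be integers. A blocked main effect plan (MEP) with $m$ factors $F_1,\dots,F_m$ on $b$ blocks of size $k$ each is an $(m+1)\times bk$ array, with rows indexed $0,1,\dots,m$. The entries of row $0$ (the block factor $B$) lie in $\{1,\dots,b\}$ and each $j\in\{1,\dots,b\}$ appears exactly $k$ times in row $0$. For $1\le i\le m$ the entries of row $i$ lie in a set $S_i$ of size $s_i$, and $F_i$ is said to have $s_i$ levels (the elements of $S_i$). Each column is a run (plot); columns with entry $j$ in row $0$ form the $j$th block. Columns may be repeated. A plan with $m$ factors each having $s$ levels is called a plan for an $s^m$ experiment. For $1\le i,j\le m$, $M_{ij}$ is the $s_i\times s_j$ matrix whose $(p,q)$ entry is the number of columns whose $i$th entry is $p$ and $j$th entry is $q$ ($p\in S_i,q\in S_j$). $M_{iB}$ is the $s_i\times b$ matrix whose $(p,j)$ entry is the number of columns whose $i$th entry is $p$ and whose row-$0$ entry is $j$. Factors $F_i,F_j$ ($i\ne j$) are orthogonal through the block factor if $M_{iB}(M_{jB})'=k\,M_{ij}$ (prime denotes transpose). A POTB (plan orthogonal through the block factor) is a blocked MEP in which every pair of distinct factors is orthogonal through the block factor. A blocked MEP is connected if, for each $i$, $M_{iB}$ is the incidence matrix of a connected block design, i.e. the graph on $S_i$ in which two levels are adjacent when some block contains both is connected. A connected POTB is balanced if for each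 $i$, $M_{iB}$ is the treatment-versus-block incidence matrix of a balanced incomplete block design (BIBD). *)

theory Defs
  imports "HOL-Number_Theory.Prime_Powers"
begin

text \<open>
  A plan is an array \<open>A\<close> where \<open>A i c\<close> is the entry in row \<open>i\<close> and column \<open>c\<close>, with columns
  \<open>c \<in> {..<b * k}\<close>. Row \<open>0\<close> is the block factor and row \<open>i \<in> {1..m}\<close> is the factor with
  level set \<open>S i\<close>. Levels are natural numbers; as the level sets are finite, this is only
  a labelling. Values of \<open>A\<close> and \<open>S\<close> outside the stated index ranges are irrelevant.
\<close>

definition blocked_mep ::
  "nat \<Rightarrow> nat \<Rightarrow> nat \<Rightarrow> (nat \<Rightarrow> nat set) \<Rightarrow> (nat \<Rightarrow> nat \<Rightarrow> nat) \<Rightarrow> bool" where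
  "blocked_mep b k m S A \<longleftrightarrow>
     b \<ge> 1 \<and> k \<ge> 1 \<and> m \<ge> 1 \<and>
     (\<forall>c<b * k. A 0 c \<in> {1..b}) \<and>
     (\<forall>j\<in>{1..b}. card {c \<in> {..<b * k}. A 0 c = j} = k) \<and>
     (\<forall>i\<in>{1..m}. finite (S i) \<and> (\<forall>c<b * k. A i c \<in> S i))"

definition symmetric_experiment :: "nat \<Rightarrow> nat \<Rightarrow> (nat \<Rightarrow> nat set) \<Rightarrow> bool" where
  "symmetric_experiment s m S \<longleftrightarrow> (\<forall>i\<in>{1..m}. finite (S i) \<and> card (S i) = s)"

text \<open>
  For an array with \<open>n\<close> columns, \<open>cooc n A i j\<close> is the matrix \<open>M\<^sub>i\<^sub>j\<close>; since row \<open>0\<close> is the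
  block factor, \<open>cooc n A i 0\<close> is \<open>M\<^sub>i\<^sub>B\<close>. Matrices are functions of their row and column
  labels.
\<close>

definition cooc :: "nat \<Rightarrow> (nat \<Rightarrow> nat \<Rightarrow> nat) \<Rightarrow> nat \<Rightarrow> nat \<Rightarrow> nat \<Rightarrow> nat \<Rightarrow> nat" where
  "cooc n A i j p q = card {c \<in> {..<n}. A i c = p \<and> A j c = q}"

definition orthogonal_through_block ::
  "nat \<Rightarrow> nat \<Rightarrow> (nat \<Rightarrow> nat set) \<Rightarrow> (nat \<Rightarrow> nat \<Rightarrow> nat) \<Rightarrow> nat \<Rightarrow> nat \<Rightarrow> bool" where
  "orthogonal_through_block b k S A i j \<longleftrightarrow>
     (\<forall>p\<in>S i. \<forall>q\<in>S j.
        (\<Sum>t\<in>{1..b}. cooc (b * k) A i 0 p t * cooc (b * k) A j 0 q t)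
          = k * cooc (b * k) A i j p q)"

definition potb ::
  "nat \<Rightarrow> nat \<Rightarrow> nat \<Rightarrow> (nat \<Rightarrow> nat set) \<Rightarrow> (nat \<Rightarrow> nat \<Rightarrow> nat) \<Rightarrow> bool" where
  "potb b k m S A \<longleftrightarrow>
     blocked_mep b k m S A \<and>
     (\<forall>i\<in>{1..m}. \<forall>j\<in>{1..m}. i \<noteq> j \<longrightarrow> orthogonal_through_block b k S A i j)"

text \<open>
  In the following, \<open>N p t\<close> is the number of times treatment \<open>p \<in> V\<close> occurs in block \<open>t \<in> T\<close>.
\<close>

definition connected_design :: "'a set \<Rightarrow> 'b set \<Rightarrow> ('a \<Rightarrow> 'b \<Rightarrow> nat) \<Rightarrow> bool" where
  "connected_design V T N \<longleftrightarrow>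
     (\<forall>p\<in>V. \<forall>q\<in>V.
        (p, q) \<in> {(x, y). x \<in> V \<and> y \<in> V \<and> (\<exists>t\<in>T. N x t > 0 \<and> N y t > 0)}\<^sup>*)"

definition connected_mep ::
  "nat \<Rightarrow> nat \<Rightarrow> nat \<Rightarrow> (nat \<Rightarrow> nat set) \<Rightarrow> (nat \<Rightarrow> nat \<Rightarrow> nat) \<Rightarrow> bool" where
  "connected_mep b k m S A \<longleftrightarrow>
     blocked_mep b k m S A \<and>
     (\<forall>i\<in>{1..m}. connected_design (S i) {1..b} (cooc (b * k) A i 0))"

text \<open>
  A BIBD on the treatment set \<open>V\<close> is a family of blocks \<open>D t\<close>, \<open>t \<in> T\<close>, that are subsets of \<open>V\<close>
  (repeated blocks are allowed): block size \<open>k\<close>, replication number \<open>r\<close>, and \<open>l\<close> blocks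
  through every pair of distinct treatments.
\<close>

definition bibd ::
  "'a set \<Rightarrow> 'b set \<Rightarrow> ('b \<Rightarrow> 'a set) \<Rightarrow> nat \<Rightarrow> nat \<Rightarrow> nat \<Rightarrow> bool" where
  "bibd V T D k r l \<longleftrightarrow>
     finite V \<and> finite T \<and> 2 \<le> k \<and> k < card V \<and>
     (\<forall>t\<in>T. D t \<subseteq> V \<and> card (D t) = k) \<and>
     (\<forall>p\<in>V. card {t \<in> T. p \<in> D t} = r) \<and>
     (\<forall>p\<in>V. \<forall>q\<in>V. p \<noteq> q \<longrightarrow> card {t \<in> T. p \<in> D t \<and> q \<in> D t} = l)"

definition is_incidence_matrix ::
  "'a set \<Rightarrow> 'b set \<Rightarrow> ('b \<Rightarrow> 'a set) \<Rightarrow> ('a \<Rightarrow> 'b \<Rightarrow> nat) \<Rightarrow> bool" where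
  "is_incidence_matrix V T D N \<longleftrightarrow>
     (\<forall>p\<in>V. \<forall>t\<in>T. N p t = (if p \<in> D t then 1 else 0))"

definition balanced_potb ::
  "nat \<Rightarrow> nat \<Rightarrow> nat \<Rightarrow> (nat \<Rightarrow> nat set) \<Rightarrow> (nat \<Rightarrow> nat \<Rightarrow> nat) \<Rightarrow> bool" where
  "balanced_potb b k m S A \<longleftrightarrow>
     potb b k m S A \<and> connected_mep b k m S A \<and>
     (\<forall>i\<in>{1..m}. \<exists>D r l.
        bibd (S i) {1..b} D k r l \<and>
        is_incidence_matrix (S i) {1..b} D (cooc (b * k) A i 0))"

end

theory Submission
  imports Defs "HOL-Algebra.Algebraic_Closure" "HOL-Number_Theory.Residues"
begin

text \<open>
  Let \<open>D\<close> be a BIBD with \<open>2 k\<close> points, block size \<open>k\<close>, replication number \<open>2 k - 1\<close> and \<open>k - 1\<close>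
  blocks through each pair of points. The complements of its blocks form a BIBD with the same
  parameters. If the first factor runs through the blocks and the second through their
  complements, then the product of the two incidence matrices counts the blocks containing \<open>p\<close>
  but not \<open>q\<close>; it is \<open>k (J - I)\<close>, with \<open>J\<close> the all-one matrix. So orthogonality through the block
  factor only asks that the points of each block be matched with those of its complement in
  such a way that each ordered pair of different points is matched exactly once. Because there are
  as many incident pairs of a point and a block as ordered pairs of different points, it suffices
  that no pair is matched twice (\<open>balanced_potb_of_bibd_with_partners\<close>).
  
  For \<open>k = (v + 1) / 2\<close> let \<open>F\<close> be the field with \<open>v\<close> elements and \<open>Q\<close> the group of its nonzero
  squares. On the points \<open>F \<union> {\<infinity>}\<close> take as blocks the translates of \<open>Q \<union> {\<infinity>}\<close> and of
  \<open>- Q \<union> {0}\<close>. The design is balanced (\<open>bibd_block\<close>) because, for \<open>d \<noteq> 0\<close>, the ratio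
  \<open>(u + d) / u\<close> runs through all elements of \<open>F\<close> except \<open>1\<close>, which counts the pairs \<open>u, u + d\<close>
  inside \<open>Q\<close> and those inside the set of nonsquares (\<open>card_square_pairs\<close>).
  
  For the matching fix a nonsquare \<open>n\<close>. In \<open>Q \<union> {\<infinity>}\<close> match \<open>\<infinity>\<close> with \<open>0\<close> and \<open>y\<close> with \<open>n y\<close>; in
  \<open>- Q \<union> {0}\<close> match \<open>0\<close> with \<open>\<infinity>\<close> and \<open>y\<close> with \<open>y / n\<close>; then translate. The differences between a
  point and its match are \<open>(n - 1) q\<close> in the first family and \<open>(1 - 1/n) q\<close> in the second, where
  \<open>q\<close> runs through \<open>Q\<close>. The ratio of \<open>n - 1\<close> and \<open>1 - 1/n\<close> is the nonsquare \<open>n\<close>, so each nonzero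
  difference occurs once (\<open>partner_pairs_inj\<close>).
  
  The field \<open>F\<close> is realised as the set of roots of \<open>X\<^sup>v - X\<close> in an algebraic closure of the prime
  field (\<open>finite_field_of_prime_power_order\<close>).
\<close>

section \<open>Finite fields of prime power order\<close>

lemma (in cring) binomial_expansion:
  fixes n :: nat
  assumes x: "x \<in> carrier R" and y: "y \<in> carrier R"
  shows "(x \<oplus> y) [^] n = (\<Oplus>i\<in>{..n}. [(n choose i)] \<cdot> (x [^] i \<otimes> y [^] (n - i)))"
proof (induction n)
  case 0
  then show ?case using x y by simp
next
  case (Suc n)
  define t where "t i = x [^] i \<otimes> y [^] (Suc n - i)" for i
  have t: "t i \<in> carrier R" for i using x y by (simp add: t_def)
  have up: "[(n choose i)] \<cdot> (x [^] i \<otimes> y [^] (n - i)) \<otimes> x = [(n choose i)] \<cdot> t (Suc i)" for i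
  proof -
    have "(x [^] i \<otimes> y [^] (n - i)) \<otimes> x = t (Suc i)"
      using x y by (simp add: t_def m_ac)
    then show ?thesis
      using x y t by (simp add: add_pow_ldistr)
  qed
  have keep: "[(n choose i)] \<cdot> (x [^] i \<otimes> y [^] (n - i)) \<otimes> y = [(n choose i)] \<cdot> t i" if "i \<le> n" for i
  proof -
    have "(x [^] i \<otimes> y [^] (n - i)) \<otimes> y = t i"
      using x y that by (simp add: t_def m_assoc Suc_diff_le)
    then show ?thesis
      using x y t by (simp add: add_pow_ldistr)
  qed
  have "(x \<oplus> y) [^] Suc n
      = (\<Oplus>i\<in>{..n}. [(n choose i)] \<cdot> (x [^] i \<otimes> y [^] (n - i))) \<otimes> (x \<oplus> y)"
    using Suc.IH by simp
  also have "\<dots> = (\<Oplus>i\<in>{..n}. [(n choose i)] \<cdot> (x [^] i \<otimes> y [^] (n - i)) \<otimes> x)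
      \<oplus> (\<Oplus>i\<in>{..n}. [(n choose i)] \<cdot> (x [^] i \<otimes> y [^] (n - i)) \<otimes> y)"
    using x y by (simp add: r_distr finsum_ldistr)
  also have "(\<Oplus>i\<in>{..n}. [(n choose i)] \<cdot> (x [^] i \<otimes> y [^] (n - i)) \<otimes> x)
      = (\<Oplus>i\<in>{..n}. [(n choose i)] \<cdot> t (Suc i))"
    using up by simp
  also have "(\<Oplus>i\<in>{..n}. [(n choose i)] \<cdot> (x [^] i \<otimes> y [^] (n - i)) \<otimes> y)
      = (\<Oplus>i\<in>{..n}. [(n choose i)] \<cdot> t i)"
    by (intro add.finprod_cong') (use t keep in auto)
  also have "(\<Oplus>i\<in>{..n}. [(n choose i)] \<cdot> t i) = (\<Oplus>i\<in>{..Suc n}. [(n choose i)] \<cdot> t i)"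
    using t by (subst add.finprod_Suc) (auto simp: binomial_eq_0)
  also have "\<dots> = (\<Oplus>i\<in>{..n}. [(n choose Suc i)] \<cdot> t (Suc i)) \<oplus> [(n choose 0)] \<cdot> t 0"
    using t by (subst add.finprod_Suc2) auto
  also have "(\<Oplus>i\<in>{..n}. [(n choose i)] \<cdot> t (Suc i)) \<oplus> ((\<Oplus>i\<in>{..n}. [(n choose Suc i)] \<cdot> t (Suc i)) \<oplus> [(n choose 0)] \<cdot> t 0)
     = (\<Oplus>i\<in>{..n}. [(n choose i)] \<cdot> t (Suc i) \<oplus> [(n choose Suc i)] \<cdot> t (Suc i)) \<oplus> [(n choose 0)] \<cdot> t 0"
    using t by (subst add.finprod_multf) (auto simp: a_assoc)
  also have "(\<Oplus>i\<in>{..n}. [(n choose i)] \<cdot> t (Suc i) \<oplus> [(n choose Suc i)] \<cdot> t (Suc i))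
     = (\<Oplus>i\<in>{..n}. [(Suc n choose Suc i)] \<cdot> t (Suc i))"
    using t by (intro add.finprod_cong') (auto simp: add.nat_pow_mult)
  also have "\<dots> \<oplus> [(n choose 0)] \<cdot> t 0 = (\<Oplus>i\<in>{..Suc n}. [(Suc n choose i)] \<cdot> t i)"
    using t by (subst add.finprod_Suc2) auto
  finally show ?case unfolding t_def .
qed

text \<open>
  The inner binomial coefficients of a prime exponent are divisible by that prime, so the
  \<open>p\<close>-th power map is additive in characteristic \<open>p\<close>, and so are its iterates.
\<close>

lemma (in cring) frobenius_add:
  fixes p n :: nat
  assumes p: "Factorial_Ring.prime p" and char: "[p] \<cdot> \<one> = \<zero>"
    and x: "x \<in> carrier R" and y: "y \<in> carrier R"
  shows "(x \<oplus> y) [^] (p ^ n) = x [^] (p ^ n) \<oplus> y [^] (p ^ n)"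
proof (induction n)
  case 0
  then show ?case using x y by (simp add: nat_pow_eone)
next
  case (Suc n)
  have ann: "[(p * m)] \<cdot> z = \<zero>" if "z \<in> carrier R" for z m
  proof -
    have "[p] \<cdot> z = [p] \<cdot> \<one> \<otimes> z" using that by (simp add: add_pow_ldistr)
    then have "[p] \<cdot> z = \<zero>" using char that by simp
    then show ?thesis using that by (metis add.nat_pow_one add.nat_pow_pow)
  qed
  have *: "(a \<oplus> b) [^] p = a [^] p \<oplus> b [^] p" if a: "a \<in> carrier R" and b: "b \<in> carrier R" for a b
  proof -
    obtain k where k: "p = Suc (Suc k)"
      using prime_ge_2_nat[OF p] by (metis add_2_eq_Suc le_Suc_ex)
    let ?f = "\<lambda>i. [(p choose i)] \<cdot> (a [^] i \<otimes> b [^] (p - i))"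
    have f: "?f i \<in> carrier R" for i using a b by simp
    have mid: "?f (Suc i) = \<zero>" if "i \<le> k" for i
    proof -
      have "p dvd (p choose Suc i)"
        using p that k by (intro dvd_choose_prime) auto
      then show ?thesis using ann a b by (auto simp: dvd_def)
    qed
    have "(a \<oplus> b) [^] p = (\<Oplus>i\<in>{..p}. ?f i)" by (rule binomial_expansion[OF a b])
    also have "\<dots> = ?f p \<oplus> (\<Oplus>i\<in>{..Suc k}. ?f i)"
      using f by (subst k, subst add.finprod_Suc) (auto simp: k)
    also have "(\<Oplus>i\<in>{..Suc k}. ?f i) = (\<Oplus>i\<in>{..k}. ?f (Suc i)) \<oplus> ?f 0"
      using f by (subst add.finprod_Suc2) auto
    also have "(\<Oplus>i\<in>{..k}. ?f (Suc i)) = \<zero>"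
      by (intro add.finprod_one_eqI) (use mid in auto)
    finally show ?thesis using a b by simp
  qed
  have "(x \<oplus> y) [^] (p ^ Suc n) = ((x \<oplus> y) [^] (p ^ n)) [^] p"
    using x y by (simp add: nat_pow_pow mult.commute)
  also have "\<dots> = (x [^] (p ^ n)) [^] p \<oplus> (y [^] (p ^ n)) [^] p"
    using Suc.IH * x y by simp
  finally show ?case using x y by (simp add: nat_pow_pow mult.commute)
qed

text \<open>
  A derivative without calculus: \<open>h\<close> identifies \<open>x\<close> with \<open>a\<close>, so the image of the cofactor of
  \<open>x - a\<close> in \<open>x\<^sup>n - a\<^sup>n\<close> is the derivative of the \<open>n\<close>-th power at \<open>h a\<close>. For \<open>h\<close> the
  evaluation of polynomials at \<open>a\<close> this decides whether \<open>a\<close> is a simple root.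
\<close>

lemma (in ring_hom_cring) power_diff_factor:
  fixes n :: nat
  assumes x: "x \<in> carrier R" and a: "a \<in> carrier R" and eq: "h x = h a"
  shows "\<exists>g\<in>carrier R. x [^] n \<ominus> a [^] n = (x \<ominus> a) \<otimes> g \<and> h g = [n] \<cdot>\<^bsub>S\<^esub> (h a [^]\<^bsub>S\<^esub> (n - 1))"
proof (induction n)
  case 0
  show ?case using x a by (intro bexI[of _ \<zero>]) (auto simp: R.minus_eq R.r_neg)
next
  case (Suc n)
  then obtain g where g: "g \<in> carrier R" "x [^] n \<ominus> a [^] n = (x \<ominus> a) \<otimes> g"
    and hg: "h g = [n] \<cdot>\<^bsub>S\<^esub> (h a [^]\<^bsub>S\<^esub> (n - 1))" by blast
  have xn: "x [^] n = (x \<ominus> a) \<otimes> g \<oplus> a [^] n"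
  proof -
    have "x [^] n = (x [^] n \<ominus> a [^] n) \<oplus> a [^] n"
      using x a by (simp add: R.minus_eq R.a_assoc R.l_neg)
    then show ?thesis using g by simp
  qed
  have "x [^] Suc n \<ominus> a [^] Suc n = x [^] n \<otimes> x \<ominus> a [^] n \<otimes> a" by simp
  also have "\<dots> = ((x \<ominus> a) \<otimes> g \<oplus> a [^] n) \<otimes> x \<ominus> a [^] n \<otimes> a" by (simp only: xn)
  also have "\<dots> = (x \<ominus> a) \<otimes> (g \<otimes> x \<oplus> a [^] n)"
  proof -
    have "(d \<otimes> g \<oplus> e) \<otimes> x \<ominus> e \<otimes> a = d \<otimes> (g \<otimes> x) \<oplus> (x \<ominus> a) \<otimes> e"
      if "d \<in> carrier R" "e \<in> carrier R" for d e
      using that x a g by algebra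
    from this[of "x \<ominus> a" "a [^] n"] show ?thesis
      using x a g by (simp add: R.r_distr)
  qed
  finally have 1: "x [^] Suc n \<ominus> a [^] Suc n = (x \<ominus> a) \<otimes> (g \<otimes> x \<oplus> a [^] n)" .
  have "h (g \<otimes> x \<oplus> a [^] n) = [n] \<cdot>\<^bsub>S\<^esub> (h a [^]\<^bsub>S\<^esub> (n - 1)) \<otimes>\<^bsub>S\<^esub> h a \<oplus>\<^bsub>S\<^esub> h a [^]\<^bsub>S\<^esub> n"
    using x a g eq hg by simp
  also have "\<dots> = [n] \<cdot>\<^bsub>S\<^esub> (h a [^]\<^bsub>S\<^esub> n) \<oplus>\<^bsub>S\<^esub> h a [^]\<^bsub>S\<^esub> n"
    using a by (cases n) (simp_all add: S.add_pow_ldistr S.l_distr)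
  finally have "h (g \<otimes> x \<oplus> a [^] n) = [Suc n] \<cdot>\<^bsub>S\<^esub> (h a [^]\<^bsub>S\<^esub> (Suc n - 1))"
    using a by simp
  with 1 show ?case using g x a by blast
qed

text \<open>
  Membership in the smaller ring \<open>K[X]\<close> is what makes the polynomial split in an algebraic
  closure of \<open>K\<close>; its operations are those of \<open>poly_ring R\<close>.
\<close>

lemma (in domain) var_pow_minus_var:
  assumes K: "subring K R" and q: "q > 1"
  shows "X [^]\<^bsub>poly_ring R\<^esub> q \<ominus>\<^bsub>poly_ring R\<^esub> X \<in> carrier (K[X])"
    and "degree (X [^]\<^bsub>poly_ring R\<^esub> q \<ominus>\<^bsub>poly_ring R\<^esub> X) = q"
proof -
  have inv: "\<ominus>\<^bsub>poly_ring R\<^esub> X = map (a_inv R) X"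
    by (rule univ_poly_a_inv_def'[OF carrier_is_subring var_closed(1)[OF carrier_is_subring]])
  have invK: "\<ominus>\<^bsub>K[X]\<^esub> X = map (a_inv R) X"
    by (rule univ_poly_a_inv_def'[OF K var_closed(1)[OF K]])
  interpret UK: ring "K[X]" by (rule univ_poly_is_ring[OF K])
  have eq: "X [^]\<^bsub>poly_ring R\<^esub> q \<ominus>\<^bsub>poly_ring R\<^esub> X = X [^]\<^bsub>K[X]\<^esub> q \<ominus>\<^bsub>K[X]\<^esub> X"
    by (simp add: a_minus_def inv invK univ_poly_add unitary_monom_eq_var_pow[OF K, symmetric]
        unitary_monom_eq_var_pow[OF carrier_is_subring, symmetric])
  have cl: "X [^]\<^bsub>K[X]\<^esub> q \<in> carrier (K[X])" "\<ominus>\<^bsub>K[X]\<^esub> X \<in> carrier (K[X])"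
    using var_closed(1)[OF K] by auto
  then show "X [^]\<^bsub>poly_ring R\<^esub> q \<ominus>\<^bsub>poly_ring R\<^esub> X \<in> carrier (K[X])"
    unfolding eq by (intro UK.minus_closed) (use var_closed(1)[OF K] in auto)
  have d1: "degree (X [^]\<^bsub>K[X]\<^esub> q) = q"
    by (simp add: unitary_monom_eq_var_pow[OF K, symmetric] monom_def)
  have d2: "degree (\<ominus>\<^bsub>K[X]\<^esub> X) = 1"
    unfolding invK by (simp add: var_def)
  have "degree (poly_add (X [^]\<^bsub>K[X]\<^esub> q) (\<ominus>\<^bsub>K[X]\<^esub> X)) = max q 1"
    using poly_add_degree_eq[OF K, of "X [^]\<^bsub>K[X]\<^esub> q" "\<ominus>\<^bsub>K[X]\<^esub> X"] cl q
    unfolding univ_poly_carrier d1 d2 by simp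
  then show "degree (X [^]\<^bsub>poly_ring R\<^esub> q \<ominus>\<^bsub>poly_ring R\<^esub> X) = q"
    using q unfolding eq by (simp add: a_minus_def univ_poly_add)
qed

text \<open>
  The derivative of \<open>X\<^sup>q - X\<close> is the constant \<open>-1\<close> when \<open>q\<close> vanishes in the field. Hence every
  root is simple, and a splitting polynomial of degree \<open>q\<close> has \<open>q\<close> different roots.
\<close>

lemma (in field) card_roots_var_pow_minus_var:
  assumes q: "q > 1" and char: "[q] \<cdot> \<one> = \<zero>"
    and split: "splitted (X [^]\<^bsub>poly_ring R\<^esub> q \<ominus>\<^bsub>poly_ring R\<^esub> X)"
  shows "finite {a \<in> carrier R. a [^] q = a}" and "card {a \<in> carrier R. a [^] q = a} = q"
proof -
  interpret UP: domain "poly_ring R" by (rule univ_poly_is_domain[OF carrier_is_subring])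
  let ?P = "X [^]\<^bsub>poly_ring R\<^esub> q \<ominus>\<^bsub>poly_ring R\<^esub> X"
  note P = var_pow_minus_var[OF carrier_is_subring q]
  have P0: "?P \<noteq> []" using P(2) q by auto
  have Xc: "X \<in> carrier (poly_ring R)" by (rule var_closed(1)[OF carrier_is_subring])
  have root: "is_root ?P a \<longleftrightarrow> a \<in> carrier R \<and> a [^] q = a" for a
  proof (cases "a \<in> carrier R")
    case True
    interpret ev: ring_hom_cring "poly_ring R" R "\<lambda>p. eval p a"
      by (rule eval_cring_hom[OF carrier_is_subring True])
    have "eval ?P a = a [^] q \<ominus> a"
      using True Xc by (simp add: UP.minus_eq minus_eq eval_var)
    then show ?thesis
      using True P0 by (simp add: is_root_def)
  qed (simp add: is_root_def)
  have simple: "count (roots ?P) a = 1" if a: "a \<in> carrier R" and aq: "a [^] q = a" for a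
  proof -
    interpret ev: ring_hom_cring "poly_ring R" R "\<lambda>p. eval p a"
      by (rule eval_cring_hom[OF carrier_is_subring a])
    have emb: "poly_of_const \<in> ring_hom R (poly_ring R)"
      using canonical_embedding_is_hom[OF carrier_is_subring] by simp
    interpret em: ring_hom_cring R "poly_ring R" poly_of_const
      by (intro ring_hom_cring.intro ring_hom_cring_axioms.intro emb) unfold_locales
    have hom_pow: "poly_of_const (a [^] k) = poly_of_const a [^]\<^bsub>poly_ring R\<^esub> k" for k :: nat
      using a by (induction k) auto
    let ?c = "poly_of_const a"
    have c: "?c \<in> carrier (poly_ring R)" using a by simp
    have cq: "?c [^]\<^bsub>poly_ring R\<^esub> q = ?c" using a aq by (metis hom_pow)
    have evc: "eval ?c a = a" using a by (simp add: poly_of_const_def)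
    obtain g where g: "g \<in> carrier (poly_ring R)"
      and fac: "X [^]\<^bsub>poly_ring R\<^esub> q \<ominus>\<^bsub>poly_ring R\<^esub> ?c [^]\<^bsub>poly_ring R\<^esub> q
          = (X \<ominus>\<^bsub>poly_ring R\<^esub> ?c) \<otimes>\<^bsub>poly_ring R\<^esub> g"
      and evg: "eval g a = [q] \<cdot> (eval ?c a [^] (q - 1))"
      using ev.power_diff_factor[OF Xc c, of q] a evc by (auto simp: eval_var)
    have lin: "X \<ominus>\<^bsub>poly_ring R\<^esub> ?c = [\<one>, \<ominus> a]"
      unfolding a_minus_def univ_poly_add univ_poly_a_inv_def'[OF carrier_is_subring c]
      using a by (auto simp: poly_of_const_def var_def)
    let ?h = "g \<ominus>\<^bsub>poly_ring R\<^esub> \<one>\<^bsub>poly_ring R\<^esub>"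
    have h: "?h \<in> carrier (poly_ring R)" using g by simp
    \<comment> \<open>As \<open>c\<^sup>q = c\<close> for the constant \<open>c = a\<close>, both \<open>X\<^sup>q - c\<^sup>q\<close> and \<open>X - c\<close> contain the
      factor \<open>X - a\<close>.\<close>
    have "A \<ominus>\<^bsub>poly_ring R\<^esub> X = (A \<ominus>\<^bsub>poly_ring R\<^esub> ?c) \<ominus>\<^bsub>poly_ring R\<^esub> (X \<ominus>\<^bsub>poly_ring R\<^esub> ?c)"
      if "A \<in> carrier (poly_ring R)" for A
      using that Xc c by algebra
    from this[of "X [^]\<^bsub>poly_ring R\<^esub> q"]
    have "?P = (X \<ominus>\<^bsub>poly_ring R\<^esub> ?c) \<otimes>\<^bsub>poly_ring R\<^esub> g \<ominus>\<^bsub>poly_ring R\<^esub> (X \<ominus>\<^bsub>poly_ring R\<^esub> ?c)"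
      using Xc fac cq by simp
    also have "\<dots> = (X \<ominus>\<^bsub>poly_ring R\<^esub> ?c) \<otimes>\<^bsub>poly_ring R\<^esub> ?h"
      using Xc c g by algebra
    finally have Pfac: "?P = [\<one>, \<ominus> a] \<otimes>\<^bsub>poly_ring R\<^esub> ?h" unfolding lin .
    have "[q] \<cdot> z = [q] \<cdot> \<one> \<otimes> z" if "z \<in> carrier R" for z
      using that by (simp add: add_pow_ldistr)
    then have "eval g a = \<zero>" unfolding evg evc using a char by simp
    then have "eval ?h a = \<ominus> \<one>" using g by (simp add: UP.minus_eq)
    then have "eval ?h a \<noteq> \<zero>" by simp
    then have "\<not> is_root ?h a" by (simp add: is_root_def)
    then have "count (roots ?h) a = 0"
      using roots_mem_iff_is_root[OF h] by (simp add: count_eq_zero_iff)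
    moreover have "?h \<noteq> []" using \<open>eval ?h a \<noteq> \<zero>\<close> by auto
    ultimately show ?thesis
      unfolding Pfac using poly_mult_degree_one_monic_imp_same_roots[OF a h] by simp
  qed
  have set: "set_mset (roots ?P) = {a \<in> carrier R. a [^] q = a}"
    using roots_mem_iff_is_root[OF P(1)] root by auto
  then show "finite {a \<in> carrier R. a [^] q = a}" by (simp flip: set)
  have "q = size (roots ?P)" using split P(2) by (simp add: splitted_def)
  also have "\<dots> = (\<Sum>a\<in>set_mset (roots ?P). 1)"
    unfolding size_multiset_overloaded_eq by (rule sum.cong) (use set simple in auto)
  finally show "card {a \<in> carrier R. a [^] q = a} = q" unfolding set by simp
qed

lemma (in field) subfield_frobenius_fixed:
  fixes p n :: nat
  assumes p: "Factorial_Ring.prime p" and char: "[p] \<cdot> \<one> = \<zero>"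
  shows "subfield {a \<in> carrier R. a [^] (p ^ n) = a} R"
proof (rule subfieldI'[OF subringI])
  have q: "p ^ n > 0" using p prime_gt_0_nat by simp
  fix a assume "a \<in> {a \<in> carrier R. a [^] (p ^ n) = a}"
  then have a: "a \<in> carrier R" "a [^] (p ^ n) = a" by auto
  have "a \<oplus> (\<ominus> a) [^] (p ^ n) = (a \<oplus> \<ominus> a) [^] (p ^ n)"
    using frobenius_add[OF p char a(1), of "\<ominus> a" n] a by simp
  also have "\<dots> = \<zero>" using a q by (simp add: r_neg nat_pow_zero)
  finally have "(\<ominus> a) [^] (p ^ n) = \<ominus> a"
    using a by (metis a_inv_closed minus_equality nat_pow_closed a_comm)
  then show "\<ominus> a \<in> {a \<in> carrier R. a [^] (p ^ n) = a}" using a by simp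
next
  fix a assume "a \<in> {a \<in> carrier R. a [^] (p ^ n) = a} - {\<zero>}"
  then have a: "a \<in> carrier R" "a [^] (p ^ n) = a" and u: "a \<in> Units R" by (auto simp: field_Units)
  have "inv a [^] (p ^ n) \<otimes> a [^] (p ^ n) = (inv a \<otimes> a) [^] (p ^ n)"
    by (rule nat_pow_distrib[symmetric]) (use a u in auto)
  then have "inv a [^] (p ^ n) \<otimes> a = \<one>" using u a by simp
  then have "inv a [^] (p ^ n) = inv a"
    using a u by (metis Units_inv_closed comm_inv_char m_comm nat_pow_closed)
  then show "inv a \<in> {a \<in> carrier R. a [^] (p ^ n) = a}" using u by simp
qed (auto simp: frobenius_add[OF p char] nat_pow_distrib)

text \<open>
  The field consists of the fixed points of \<open>x \<mapsto> x\<^sup>q\<close> in an algebraic closure of the prime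
  field.
\<close>

theorem finite_field_of_prime_power_order:
  assumes "primepow q"
  obtains F :: "((int list \<times> nat) multiset \<Rightarrow> int) ring"
  where "field F" and "finite (carrier F)" and "card (carrier F) = q"
proof -
  obtain p n where p: "Factorial_Ring.prime p" and n: "n > 0" and q: "q = p ^ n"
    using assms by (auto simp: primepow_def)
  define Z where "Z = residue_ring (int p)"
  interpret Z: residues_prime p Z by unfold_locales (use p Z_def in auto)
  obtain L :: "((int list \<times> nat) multiset \<Rightarrow> int) ring"
    where cl: "algebraic_closure L (Z.indexed_const ` carrier Z)"
    and hom: "Z.indexed_const \<in> ring_hom Z L"
    by (rule Z.exists_closure)
  interpret L: algebraic_closure L "Z.indexed_const ` carrier Z" by (rule cl)
  interpret em: ring_hom_ring Z L Z.indexed_const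
    by (intro ring_hom_ring.intro ring_hom_ring_axioms.intro hom) unfold_locales
  have "[k] \<cdot>\<^bsub>Z\<^esub> \<one>\<^bsub>Z\<^esub> = int k mod int p" for k
    by (induction k) (auto simp: Z.res_zero_eq Z.res_one_eq Z.res_add_eq mod_simps add.commute)
  then have Zp: "[p] \<cdot>\<^bsub>Z\<^esub> \<one>\<^bsub>Z\<^esub> = \<zero>\<^bsub>Z\<^esub>" by (simp add: Z.res_zero_eq)
  have "Z.indexed_const ([k] \<cdot>\<^bsub>Z\<^esub> \<one>\<^bsub>Z\<^esub>) = [k] \<cdot>\<^bsub>L\<^esub> \<one>\<^bsub>L\<^esub>" for k :: nat
    by (induction k) auto
  then have char: "[p] \<cdot>\<^bsub>L\<^esub> \<one>\<^bsub>L\<^esub> = \<zero>\<^bsub>L\<^esub>" using Zp by (metis em.hom_zero)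
  have q1: "q > 1" using p n q by (metis one_less_power prime_gt_1_nat)
  obtain m where m: "q = p * m" using q n by (metis Suc_pred power_Suc)
  have charq: "[q] \<cdot>\<^bsub>L\<^esub> \<one>\<^bsub>L\<^esub> = \<zero>\<^bsub>L\<^esub>"
    using L.add.nat_pow_pow[of "\<one>\<^bsub>L\<^esub>" m p] char by (simp add: m)
  let ?S = "{a \<in> carrier L. a [^]\<^bsub>L\<^esub> q = a}"
  have "subring (Z.indexed_const ` carrier Z) L" by (rule subfieldE(1)[OF L.subfield_axioms])
  then have split: "L.splitted (X\<^bsub>L\<^esub> [^]\<^bsub>poly_ring L\<^esub> q \<ominus>\<^bsub>poly_ring L\<^esub> X\<^bsub>L\<^esub>)"
    by (intro L.roots_over_subfield L.var_pow_minus_var(1) q1)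
  note card = L.card_roots_var_pow_minus_var[OF q1 charq split]
  have "subfield ?S L" using L.subfield_frobenius_fixed[OF p char] unfolding q by blast
  from that[of "L\<lparr>carrier := ?S\<rparr>"] L.subfield_iff(2)[OF this] card show thesis by simp
qed

section \<open>Squares in a finite field of odd order\<close>

locale odd_finite_field = field R for R (structure) +
  assumes finite_carrier: "finite (carrier R)" and odd_card: "odd (card (carrier R))"
begin

definition squares :: "'a set" where
  "squares = (\<lambda>x. x \<otimes> x) ` (carrier R - {\<zero>})"

lemma squares_subset: "squares \<subseteq> carrier R - {\<zero>}"
  by (auto simp: squares_def integral_iff)

lemma finite_squares: "finite squares"
  using squares_subset finite_carrier finite_subset by blast

text \<open>
  A nonzero \<open>x\<close> with \<open>x + x = 0\<close> would have order 2 in the additive group, whose order is odd.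
\<close>

lemma neg_neq_self:
  assumes x: "x \<in> carrier R" "x \<noteq> \<zero>"
  shows "\<ominus> x \<noteq> x"
proof
  assume "\<ominus> x = x"
  then have 2: "[(2::nat)] \<cdot> x = \<zero>"
    using x r_neg[of x] by (simp add: numeral_2_eq_2)
  obtain m where m: "card (carrier R) = Suc (2 * m)"
    using odd_card oddE by fastforce
  have "[(2 * m)] \<cdot> x = \<zero>"
    using 2 x by (metis add.nat_pow_one add.nat_pow_pow)
  moreover have "[(card (carrier R))] \<cdot> x = \<zero>"
    using add.pow_order_eq_1[OF x(1)] by (simp add: order_def)
  ultimately show False using x m by simp
qed

text \<open>
  Squaring is two-to-one on the nonzero elements, its fibres being \<open>{y, -y}\<close>.
\<close>

lemma card_squares: "card (carrier R) = Suc (2 * card squares)"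
proof -
  have roots: "card {x \<in> carrier R - {\<zero>}. x \<otimes> x = s} = 2" if "s \<in> squares" for s
  proof -
    obtain y where y: "y \<in> carrier R" "y \<noteq> \<zero>" "s = y \<otimes> y"
      using \<open>s \<in> squares\<close> by (auto simp: squares_def)
    have A: "x = y \<or> x = \<ominus> y" if x: "x \<in> carrier R" "x \<otimes> x = y \<otimes> y" for x
    proof -
      have "(x \<ominus> y) \<otimes> (x \<oplus> y) = x \<otimes> x \<ominus> y \<otimes> y" using x(1) y by algebra
      also have "\<dots> = \<zero>" using x y by (simp add: r_right_minus_eq)
      finally have "x \<ominus> y = \<zero> \<or> x \<oplus> y = \<zero>" using x y integral_iff by auto
      then show ?thesis using x y by (metis minus_equality r_right_minus_eq)
    qed
    have "\<ominus> y \<otimes> \<ominus> y = y \<otimes> y" using y(1) by algebra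
    then have "{y, \<ominus> y} \<subseteq> {x \<in> carrier R - {\<zero>}. x \<otimes> x = s}"
      unfolding y(3) using y(1,2) by simp
    moreover have "{x \<in> carrier R - {\<zero>}. x \<otimes> x = s} \<subseteq> {y, \<ominus> y}"
      unfolding y(3) using A by blast
    ultimately have "{x \<in> carrier R - {\<zero>}. x \<otimes> x = s} = {y, \<ominus> y}" by (rule equalityI[rotated])
    then show ?thesis using neg_neq_self[OF y(1,2)] by (simp add: card_insert_if)
  qed
  have "card (carrier R - {\<zero>}) = (\<Sum>s\<in>squares. \<Sum>x\<in>{x \<in> carrier R - {\<zero>}. x \<otimes> x = s}. 1)"
    using sum.group[of "carrier R - {\<zero>}" squares "\<lambda>x. x \<otimes> x" "\<lambda>_. 1::nat"]
      finite_carrier finite_squares by (simp add: squares_def)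
  also have "\<dots> = 2 * card squares" using roots by simp
  finally show ?thesis using finite_carrier by (metis card.remove zero_closed)
qed

lemma mult_squares: "a \<in> squares \<Longrightarrow> b \<in> squares \<Longrightarrow> a \<otimes> b \<in> squares"
proof -
  assume "a \<in> squares" "b \<in> squares"
  then obtain x y where xy: "x \<in> carrier R" "x \<noteq> \<zero>" "y \<in> carrier R" "y \<noteq> \<zero>"
    and ab: "a = x \<otimes> x" "b = y \<otimes> y" by (auto simp: squares_def)
  have "a \<otimes> b = (x \<otimes> y) \<otimes> (x \<otimes> y)" unfolding ab using xy by (simp add: m_ac)
  moreover have "x \<otimes> y \<in> carrier R - {\<zero>}" using xy by (simp add: integral_iff)
  ultimately show ?thesis by (auto simp: squares_def)
qed

lemma cancel_square:
  assumes a: "a \<in> squares" and b: "b \<in> carrier R" and ab: "a \<otimes> b \<in> squares"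
  shows "b \<in> squares"
proof -
  obtain x where x: "x \<in> carrier R" "x \<noteq> \<zero>" "a = x \<otimes> x" using a by (auto simp: squares_def)
  obtain y where y: "y \<in> carrier R" "y \<noteq> \<zero>" "a \<otimes> b = y \<otimes> y" using ab by (auto simp: squares_def)
  have u: "x \<in> Units R" using x by (simp add: field_Units)
  have "b = (inv x \<otimes> inv x) \<otimes> (a \<otimes> b)"
  proof -
    have "(inv x \<otimes> inv x) \<otimes> (a \<otimes> b) = (inv x \<otimes> x) \<otimes> (inv x \<otimes> x) \<otimes> b"
      using x u b by (simp add: m_ac del: Units_l_inv Units_r_inv)
    then show ?thesis using u b by simp
  qed
  also have "\<dots> = (inv x \<otimes> y) \<otimes> (inv x \<otimes> y)"
    unfolding y(3) using u y by (simp add: m_ac)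
  finally have "b = (inv x \<otimes> y) \<otimes> (inv x \<otimes> y)" .
  moreover have "inv x \<otimes> y \<noteq> \<zero>"
    using x y u by (metis Units_inv_Units field_Units integral_iff Diff_iff Units_inv_closed insertI1)
  ultimately show ?thesis using u y by (auto simp: squares_def)
qed

text \<open>
  For a nonsquare \<open>n\<close> the coset \<open>n Q\<close> of the group \<open>Q\<close> of nonzero squares is disjoint from \<open>Q\<close>
  and has half of the nonzero elements. So it contains all nonsquares, and \<open>n (n q) = n\<^sup>2 q\<close> is a
  square.
\<close>

lemma mult_nonsquares:
  assumes n: "n \<in> carrier R - {\<zero>}" "n \<notin> squares" and m: "m \<in> carrier R - {\<zero>}" "m \<notin> squares"
  shows "n \<otimes> m \<in> squares"
proof -
  let ?nQ = "(\<otimes>) n ` squares"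
  have inj: "inj_on ((\<otimes>) n) squares"
  proof (rule inj_onI)
    fix a b assume "a \<in> squares" "b \<in> squares" "n \<otimes> a = n \<otimes> b"
    then show "a = b" using m_lcancel[of n a b] n squares_subset by auto
  qed
  have disj: "?nQ \<inter> squares = {}"
  proof -
    have "n \<otimes> q \<notin> squares" if "q \<in> squares" for q
      using cancel_square[OF that, of n] n m_comm[of n q] squares_subset that by auto
    then show ?thesis by blast
  qed
  have sub: "?nQ \<union> squares \<subseteq> carrier R - {\<zero>}"
    using n squares_subset by (auto simp: integral_iff)
  have "card (?nQ \<union> squares) = 2 * card squares"
    using disj finite_squares inj by (simp add: card_Un_disjoint card_image)
  also have "\<dots> = card (carrier R - {\<zero>})"
    using card_squares finite_carrier by simp
  finally have "?nQ \<union> squares = carrier R - {\<zero>}"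
    using sub finite_carrier by (meson card_subset_eq finite_Diff)
  then obtain q where q: "q \<in> squares" "m = n \<otimes> q" using m by auto
  have "n \<otimes> m = (n \<otimes> n) \<otimes> q" using q n squares_subset by (auto simp: m_assoc)
  moreover have "n \<otimes> n \<in> squares" using n by (auto simp: squares_def)
  ultimately show ?thesis using q mult_squares by simp
qed

lemma mult_in_squares_iff:
  assumes "a \<in> carrier R - {\<zero>}" and "b \<in> carrier R - {\<zero>}"
  shows "a \<otimes> b \<in> squares \<longleftrightarrow> (a \<in> squares \<longleftrightarrow> b \<in> squares)"
  using mult_squares[of a b] mult_nonsquares[OF assms(1) _ assms(2)]
    cancel_square[of a b] cancel_square[of b a] m_comm[of a b] assms by auto

lemma one_in_squares: "\<one> \<in> squares"
  unfolding squares_def by (rule image_eqI[of _ _ \<one>]) auto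

lemma nonsquare_exists: "\<exists>n. n \<in> carrier R - {\<zero>} \<and> n \<notin> squares"
proof (rule ccontr)
  assume "\<not> ?thesis"
  then have "squares = carrier R - {\<zero>}" using squares_subset by blast
  then have "card (carrier R) = Suc (card squares)"
    using finite_carrier by (metis card.remove zero_closed)
  then have "card squares = 0" using card_squares by simp
  then show False using finite_squares one_in_squares by auto
qed

lemma card_translates:
  assumes A: "A \<subseteq> carrier R" and y: "y \<in> carrier R"
  shows "card {x \<in> carrier R. y \<ominus> x \<in> A} = card A" and "card {x \<in> carrier R. x \<ominus> y \<in> A} = card A"
proof -
  have 1: "y \<ominus> (y \<ominus> x) = x" "(x \<oplus> y) \<ominus> y = x" "(x \<ominus> y) \<oplus> y = x" if "x \<in> carrier R" for x
    using that y by algebra+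
  have "bij_betw (\<lambda>x. y \<ominus> x) {x \<in> carrier R. y \<ominus> x \<in> A} A"
    by (rule bij_betw_byWitness[where f' = "\<lambda>x. y \<ominus> x"]) (use A y 1 in auto)
  then show "card {x \<in> carrier R. y \<ominus> x \<in> A} = card A" by (rule bij_betw_same_card)
  have "bij_betw (\<lambda>x. x \<ominus> y) {x \<in> carrier R. x \<ominus> y \<in> A} A"
    by (rule bij_betw_byWitness[where f' = "\<lambda>x. x \<oplus> y"]) (use A y 1 in auto)
  then show "card {x \<in> carrier R. x \<ominus> y \<in> A} = card A" by (rule bij_betw_same_card)
qed

text \<open>
  The elements \<open>u\<close> and \<open>u + d\<close> are both squares or both nonsquares exactly when the ratio
  \<open>w = (u + d) / u\<close> is a square. The ratio determines \<open>u = d / (w - 1)\<close>, and every square except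
  \<open>1\<close> occurs.
\<close>

lemma card_same_class_translate:
  assumes d: "d \<in> carrier R" "d \<noteq> \<zero>"
  shows "card {u \<in> carrier R - {\<zero>}. u \<oplus> d \<noteq> \<zero> \<and> (u \<in> squares \<longleftrightarrow> u \<oplus> d \<in> squares)} = card squares - 1"
    (is "card ?M = _")
proof -
  let ?g = "\<lambda>w. d \<otimes> inv (w \<ominus> \<one>)" and ?f = "\<lambda>u. (u \<oplus> d) \<otimes> inv u"
  have g: "?g w \<in> ?M" "?f (?g w) = w" if w: "w \<in> squares - {\<one>}" for w
  proof -
    have wc: "w \<in> carrier R" "w \<noteq> \<zero>" "w \<ominus> \<one> \<noteq> \<zero>"
      using w squares_subset by (auto simp: r_right_minus_eq)
    then have u: "w \<ominus> \<one> \<in> Units R" by (simp add: field_Units)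
    define u where "u = ?g w"
    have uc: "u \<in> carrier R" using u d by (simp add: u_def)
    have du: "(w \<ominus> \<one>) \<otimes> u = d"
    proof -
      have "(w \<ominus> \<one>) \<otimes> u = d \<otimes> ((w \<ominus> \<one>) \<otimes> inv (w \<ominus> \<one>))"
        unfolding u_def using u d Units_closed[OF u] by (simp add: m_ac del: Units_l_inv Units_r_inv)
      then show ?thesis using u d by simp
    qed
    then have u0: "u \<noteq> \<zero>" using d wc by auto
    have "u \<oplus> d = u \<oplus> (w \<ominus> \<one>) \<otimes> u" using du by simp
    also have "\<dots> = w \<otimes> u" using uc wc by algebra
    finally have ud: "u \<oplus> d = w \<otimes> u" .
    show "?g w \<in> ?M"
      using ud uc u0 wc w mult_in_squares_iff[of w u] by (auto simp: u_def[symmetric] integral_iff)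
    have "u \<in> Units R" using uc u0 by (simp add: field_Units)
    then show "?f (?g w) = w"
      unfolding u_def[symmetric] ud using wc uc by (simp add: m_assoc)
  qed
  have f: "?f u \<in> squares - {\<one>}" "?g (?f u) = u" if u: "u \<in> ?M" for u
  proof -
    have uc: "u \<in> carrier R" "u \<noteq> \<zero>" "u \<oplus> d \<noteq> \<zero>" "u \<in> squares \<longleftrightarrow> u \<oplus> d \<in> squares"
      using u by auto
    then have uU: "u \<in> Units R" by (simp add: field_Units)
    define w where "w = ?f u"
    have wc: "w \<in> carrier R" using uc uU d by (simp add: w_def)
    have wu: "w \<otimes> u = u \<oplus> d" using uc uU d by (simp add: w_def m_assoc)
    then have w0: "w \<noteq> \<zero>" using uc by auto
    have "w \<in> squares"
      using wu uc wc w0 mult_in_squares_iff[of w u] by auto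
    moreover have "w \<noteq> \<one>"
    proof
      assume "w = \<one>"
      then have "u = u \<oplus> d" using wu uc by simp
      moreover have "(u \<oplus> d) \<ominus> u = d" using uc d by algebra
      ultimately show False using uc d by (metis r_right_minus_eq)
    qed
    ultimately show "?f u \<in> squares - {\<one>}" by (simp add: w_def)
    have "(w \<ominus> \<one>) \<otimes> u = w \<otimes> u \<ominus> u" using wc uc by algebra
    also have "\<dots> = d" unfolding wu using uc d by algebra
    finally have du: "d = (w \<ominus> \<one>) \<otimes> u" by simp
    have "w \<ominus> \<one> \<noteq> \<zero>" using \<open>w \<noteq> \<one>\<close> wc by (simp add: r_right_minus_eq)
    then have wU: "w \<ominus> \<one> \<in> Units R" using wc by (simp add: field_Units)
    have "d \<otimes> inv (w \<ominus> \<one>) = u \<otimes> ((w \<ominus> \<one>) \<otimes> inv (w \<ominus> \<one>))"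
      unfolding du using wU uc Units_closed[OF wU] by (simp add: m_ac del: Units_l_inv Units_r_inv)
    then show "?g (?f u) = u" unfolding w_def[symmetric] using wU uc by simp
  qed
  have "bij_betw ?f ?M (squares - {\<one>})"
  proof (rule bij_betw_byWitness[where f' = ?g])
    show "\<forall>u\<in>?M. ?g (?f u) = u" by (intro ballI f(2))
    show "\<forall>w\<in>squares - {\<one>}. ?f (?g w) = w" by (intro ballI g(2))
    show "?f ` ?M \<subseteq> squares - {\<one>}" by (intro image_subsetI f(1))
    show "?g ` (squares - {\<one>}) \<subseteq> ?M" by (intro image_subsetI g(1))
  qed
  then have "card ?M = card (squares - {\<one>})" by (rule bij_betw_same_card)
  then show ?thesis using one_in_squares finite_squares by simp
qed

text \<open>
  Let \<open>N\<close> be the set of nonsquares. By inclusion and exclusion, the pairs \<open>u, u + d\<close> avoiding \<open>N\<close>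
  outnumber those inside \<open>N\<close> by \<open>v - 2 |N| = 1\<close>. This turns the second summand into one plus the
  number of nonsquare pairs, and square and nonsquare pairs together were counted in the
  previous lemma.
\<close>

lemma card_square_pairs:
  assumes d: "d \<in> carrier R" "d \<noteq> \<zero>"
  shows "card {u \<in> carrier R. u \<in> squares \<and> u \<oplus> d \<in> squares}
       + card {u \<in> carrier R. u \<in> insert \<zero> squares \<and> u \<oplus> d \<in> insert \<zero> squares} = card squares"
proof -
  let ?Q = "{u \<in> carrier R. u \<in> squares \<and> u \<oplus> d \<in> squares}"
  let ?B = "{u \<in> carrier R. u \<in> insert \<zero> squares \<and> u \<oplus> d \<in> insert \<zero> squares}"
  define N where "N = carrier R - insert \<zero> squares"
  let ?N = "{u \<in> carrier R. u \<in> N \<and> u \<oplus> d \<in> N}"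
  let ?T = "{u \<in> carrier R. u \<oplus> d \<in> N}"
  have zero: "\<zero> \<notin> squares" using squares_subset by blast
  have fin: "finite N" "finite ?T" "finite ?Q" "finite ?N" "finite ?B"
    using finite_carrier by (auto simp: N_def)
  have "card (insert \<zero> squares) = Suc (card squares)"
    using squares_subset finite_squares by (subst card_insert_disjoint) auto
  then have cN: "card N = card squares"
    unfolding N_def using card_squares finite_carrier squares_subset finite_squares
    by (subst card_Diff_subset) auto
  have cN2: "card ?T = card squares"
  proof -
    have "u \<oplus> d = u \<ominus> (\<ominus> d)" if "u \<in> carrier R" for u using that d by algebra
    then have "?T = {u \<in> carrier R. u \<ominus> (\<ominus> d) \<in> N}" by auto
    then show ?thesis using card_translates(2)[of N "\<ominus> d"] d cN by (simp add: N_def)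
  qed
  have I: "card N + card ?T = card (N \<union> ?T) + card ?N"
  proof -
    have "?N = N \<inter> ?T" by (auto simp: N_def)
    then show ?thesis using card_Un_Int[OF fin(1,2)] by simp
  qed
  have "carrier R = (N \<union> ?T) \<union> ?B" using d by (auto simp: N_def)
  moreover have "(N \<union> ?T) \<inter> ?B = {}" by (auto simp: N_def)
  ultimately have "card (carrier R) = card (N \<union> ?T) + card ?B"
    using card_Un_disjoint[of "N \<union> ?T" ?B] fin by simp
  then have Q0: "card ?B = Suc (card ?N)" using I cN cN2 card_squares by simp
  have "{u \<in> carrier R - {\<zero>}. u \<oplus> d \<noteq> \<zero> \<and> (u \<in> squares \<longleftrightarrow> u \<oplus> d \<in> squares)} = ?Q \<union> ?N"
    using zero d by (auto simp: N_def)
  moreover have "?Q \<inter> ?N = {}" by (auto simp: N_def)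
  ultimately have "card ?Q + card ?N = card squares - 1"
    using card_same_class_translate[OF d] card_Un_disjoint[of ?Q ?N] fin by simp
  moreover have "card squares > 0" using one_in_squares finite_squares card_gt_0_iff by blast
  ultimately show ?thesis using Q0 by simp
qed

end

section \<open>A design on the projective line\<close>

context odd_finite_field
begin

definition levels :: "'a option set" where
  "levels = insert None (Some ` carrier R)"

definition indices :: "(bool \<times> 'a) set" where
  "indices = UNIV \<times> carrier R"

text \<open>
  With \<open>None\<close> as the point at infinity and \<open>Q\<close> the nonzero squares, \<open>(True, x)\<close> names the
  translate by \<open>x\<close> of \<open>Q \<union> {\<infinity>}\<close> and \<open>(False, x)\<close> the translate by \<open>x\<close> of \<open>- Q \<union> {0}\<close>. The sign
  makes the two families fit together whatever \<open>v\<close> is modulo 4.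
\<close>

fun block :: "bool \<times> 'a \<Rightarrow> 'a option set" where
  "block (True, x) = insert None (Some ` {y \<in> carrier R. y \<ominus> x \<in> squares})"
| "block (False, x) = Some ` {y \<in> carrier R. x \<ominus> y \<in> insert \<zero> squares}"

text \<open>
  Multiplication by a nonsquare \<open>n\<close> exchanges squares and nonsquares. So the homothety with centre
  \<open>x\<close> and ratio \<open>n\<close>, or ratio \<open>1/n\<close> for the second family, maps each finite point of a block
  other than \<open>x\<close> to a point outside. The points \<open>x\<close> and \<open>\<infinity>\<close>, of which each block contains
  exactly one, are exchanged.
\<close>

fun partner :: "'a \<Rightarrow> bool \<times> 'a \<Rightarrow> 'a option \<Rightarrow> 'a option" where
  "partner n (s, x) None = Some x"
| "partner n (True, x) (Some y) = Some (x \<oplus> n \<otimes> (y \<ominus> x))"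
| "partner n (False, x) (Some y) = (if y = x then None else Some (x \<oplus> inv n \<otimes> (y \<ominus> x)))"

lemma None_in_block [simp]: "None \<in> block (s, x) \<longleftrightarrow> s"
  by (cases s) auto

lemma card_levels: "card levels = 2 * Suc (card squares)"
  unfolding levels_def using finite_carrier card_squares
  by (subst card_insert_disjoint) (auto simp: card_image)

lemma card_indices: "card indices = 2 * card (carrier R)"
  by (simp add: indices_def card_cartesian_product)

lemma card_indices_split:
  "card {t \<in> indices. P t} = card {x \<in> carrier R. P (True, x)} + card {x \<in> carrier R. P (False, x)}"
proof -
  have "{t \<in> indices. P t} = Pair True ` {x \<in> carrier R. P (True, x)} \<union> Pair False ` {x \<in> carrier R. P (False, x)}"
  proof (rule Set.set_eqI)
    fix t :: "bool \<times> 'a"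
    show "t \<in> {t \<in> indices. P t}
      \<longleftrightarrow> t \<in> Pair True ` {x \<in> carrier R. P (True, x)} \<union> Pair False ` {x \<in> carrier R. P (False, x)}"
      by (cases t; cases "fst t") (auto simp: indices_def)
  qed
  moreover have "Pair True ` {x \<in> carrier R. P (True, x)} \<inter> Pair False ` {x \<in> carrier R. P (False, x)} = {}"
    by auto
  ultimately show ?thesis
    using finite_carrier by (simp add: card_Un_disjoint card_image inj_on_def)
qed

lemma zero_notin_squares: "\<zero> \<notin> squares"
  using squares_subset by blast

lemma card_insert_zero_squares: "card (insert \<zero> squares) = Suc (card squares)"
  using zero_notin_squares finite_squares by simp

text \<open>
  Two finite points at difference \<open>d\<close> lie in a block \<open>(True, x)\<close> when two elements at difference
  \<open>d\<close> are in \<open>Q\<close>, and in a block \<open>(False, x)\<close> when, because of the sign, two elements at the same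
  difference \<open>d\<close> are in \<open>Q \<union> {0}\<close>. So the numbers of such blocks are the two summands of
  \<open>card_square_pairs\<close>.
\<close>

lemma bibd_block: "bibd levels indices block (Suc (card squares)) (card (carrier R)) (card squares)"
proof -
  have fin: "finite levels" "finite indices"
    using finite_carrier by (auto simp: levels_def indices_def)
  have pos: "card squares > 0" using one_in_squares finite_squares card_gt_0_iff by blast
  have sub: "squares \<subseteq> carrier R" "insert \<zero> squares \<subseteq> carrier R" using squares_subset by auto
  note tr = card_translates[OF sub(1)] card_translates[OF sub(2)]
  have size: "block t \<subseteq> levels \<and> card (block t) = Suc (card squares)" if t: "t \<in> indices" for t
  proof -
    obtain s x where sx: "t = (s, x)" "x \<in> carrier R" using t by (auto simp: indices_def)
    show ?thesis
    proof (cases s)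
      case True
      then show ?thesis using sx finite_carrier tr(2)[of x]
        by (auto simp: levels_def card_insert_if card_image)
    next
      case False
      then show ?thesis using sx tr(3)[of x] card_insert_zero_squares
        by (auto simp: levels_def card_image)
    qed
  qed
  have rep: "card {t \<in> indices. p \<in> block t} = card (carrier R)" if "p \<in> levels" for p
  proof (cases p)
    case None
    then show ?thesis by (simp add: card_indices_split)
  next
    case (Some y)
    then have y: "y \<in> carrier R" using that by (auto simp: levels_def)
    have "card {t \<in> indices. p \<in> block t}
      = card {x \<in> carrier R. y \<ominus> x \<in> squares} + card {x \<in> carrier R. x \<ominus> y \<in> insert \<zero> squares}"
      unfolding card_indices_split using y Some by (simp add: image_iff)
    also have "\<dots> = card squares + Suc (card squares)"
      using tr(1)[OF y] tr(4)[OF y] card_insert_zero_squares by simp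
    finally show ?thesis using card_squares by simp
  qed
  have inf: "card {t \<in> indices. None \<in> block t \<and> Some y \<in> block t} = card squares" if y: "y \<in> carrier R" for y
    unfolding card_indices_split using y tr(1)[OF y] by (simp add: image_iff)
  have two: "card {t \<in> indices. Some y \<in> block t \<and> Some z \<in> block t} = card squares"
    if y: "y \<in> carrier R" and z: "z \<in> carrier R" and yz: "y \<noteq> z" for y z
  proof -
    let ?d = "z \<ominus> y"
    have d: "?d \<in> carrier R" "?d \<noteq> \<zero>" using y z yz by (auto simp: r_right_minus_eq)
    have shift: "(y \<ominus> x) \<oplus> ?d = z \<ominus> x" "(x \<ominus> z) \<oplus> ?d = x \<ominus> y" if "x \<in> carrier R" for x
      using that y z by algebra+
    let ?A = "{u \<in> carrier R. u \<in> squares \<and> u \<oplus> ?d \<in> squares}"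
    let ?B = "{u \<in> carrier R. u \<in> insert \<zero> squares \<and> u \<oplus> ?d \<in> insert \<zero> squares}"
    have "card {t \<in> indices. Some y \<in> block t \<and> Some z \<in> block t}
      = card {x \<in> carrier R. y \<ominus> x \<in> squares \<and> z \<ominus> x \<in> squares}
      + card {x \<in> carrier R. x \<ominus> y \<in> insert \<zero> squares \<and> x \<ominus> z \<in> insert \<zero> squares}"
      unfolding card_indices_split using y z by (simp add: image_iff)
    also have "{x \<in> carrier R. y \<ominus> x \<in> squares \<and> z \<ominus> x \<in> squares} = {x \<in> carrier R. y \<ominus> x \<in> ?A}"
      using shift(1) y by auto
    also have "card \<dots> = card ?A" using y by (intro card_translates(1)) auto
    also have "{x \<in> carrier R. x \<ominus> y \<in> insert \<zero> squares \<and> x \<ominus> z \<in> insert \<zero> squares}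
        = {x \<in> carrier R. x \<ominus> z \<in> ?B}"
      using shift(2) z by auto
    also have "card \<dots> = card ?B" using z by (intro card_translates(2)) auto
    finally show ?thesis using card_square_pairs[OF d] by simp
  qed
  have pair: "card {t \<in> indices. p \<in> block t \<and> q \<in> block t} = card squares"
    if "p \<in> levels" "q \<in> levels" "p \<noteq> q" for p q
  proof (cases p; cases q)
    fix y assume "p = None" "q = Some y"
    then show ?thesis using inf that by (auto simp: levels_def)
  next
    fix y assume *: "p = Some y" "q = None"
    have "{t \<in> indices. p \<in> block t \<and> q \<in> block t} = {t \<in> indices. None \<in> block t \<and> Some y \<in> block t}"
      using * by auto
    then show ?thesis using inf[of y] * that by (auto simp: levels_def)
  next
    fix y z assume "p = Some y" "q = Some z"
    then show ?thesis using two that by (auto simp: levels_def)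
  qed (use that in auto)
  show ?thesis
    unfolding bibd_def using fin pos size rep pair card_levels by auto
qed

lemma homothety_fixed_iff:
  assumes "x \<in> carrier R" "y \<in> carrier R" "m \<in> carrier R" "m \<noteq> \<zero>"
  shows "x \<oplus> m \<otimes> (y \<ominus> x) = x \<longleftrightarrow> y = x"
proof -
  have "x \<oplus> m \<otimes> (y \<ominus> x) = x \<longleftrightarrow> m \<otimes> (y \<ominus> x) = \<zero>"
    using assms(1-3) by simp
  then show ?thesis using assms by (simp add: integral_iff)
qed

lemma homothety_inj:
  assumes "x \<in> carrier R" "y \<in> carrier R" "z \<in> carrier R" "m \<in> carrier R" "m \<noteq> \<zero>"
    and "x \<oplus> m \<otimes> (y \<ominus> x) = x \<oplus> m \<otimes> (z \<ominus> x)"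
  shows "y = z"
proof -
  have "m \<otimes> (y \<ominus> x) = m \<otimes> (z \<ominus> x)" using assms by simp
  then have "y \<ominus> x = z \<ominus> x" using assms m_lcancel by simp
  then have "(y \<ominus> x) \<oplus> x = (z \<ominus> x) \<oplus> x" by simp
  moreover have "(a \<ominus> x) \<oplus> x = a" if "a \<in> carrier R" for a using that assms(1) by algebra
  ultimately show ?thesis using assms by simp
qed

text \<open>
  The image of \<open>y\<close> under the homothety with centre \<open>x\<close> and ratio \<open>m\<close> is the
  image of \<open>x\<close> under the homothety with centre \<open>y\<close> and ratio \<open>1 - m\<close>.
\<close>

lemma homothety_centre_inj:
  assumes "x \<in> carrier R" "x' \<in> carrier R" "y \<in> carrier R" "m \<in> carrier R" "m \<noteq> \<one>"
    and eq: "x \<oplus> m \<otimes> (y \<ominus> x) = x' \<oplus> m \<otimes> (y \<ominus> x')"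
  shows "x = x'"
proof -
  have "x \<oplus> m \<otimes> (y \<ominus> x) = y \<oplus> (\<one> \<ominus> m) \<otimes> (x \<ominus> y)" if "x \<in> carrier R" for x
    using that assms(3,4) by algebra
  then have "y \<oplus> (\<one> \<ominus> m) \<otimes> (x \<ominus> y) = y \<oplus> (\<one> \<ominus> m) \<otimes> (x' \<ominus> y)" using assms eq by metis
  moreover have "\<one> \<ominus> m \<noteq> \<zero>" using assms by (simp add: r_right_minus_eq)
  ultimately show ?thesis using assms by (intro homothety_inj[of y x x' "\<one> \<ominus> m"]) auto
qed

lemma nonsquare_mult_square:
  assumes "m \<in> carrier R - {\<zero>}" "m \<notin> squares" "a \<in> squares"
  shows "m \<otimes> a \<notin> insert \<zero> squares"
  using assms mult_in_squares_iff[of m a] squares_subset by (auto simp: integral_iff)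

context
  fixes n
  assumes n: "n \<in> carrier R - {\<zero>}" "n \<notin> squares"
begin

lemma inverse_nonsquare:
  shows "inv n \<in> carrier R - {\<zero>}" and "inv n \<notin> squares" and "n \<otimes> inv n = \<one>"
proof -
  have u: "n \<in> Units R" using n by (simp add: field_Units)
  then show i: "inv n \<in> carrier R - {\<zero>}" using Units_inv_Units field_Units by blast
  show e: "n \<otimes> inv n = \<one>" using u by simp
  show "inv n \<notin> squares" using mult_in_squares_iff[OF n(1) i] n e one_in_squares by simp
qed

lemma partner_outside_block:
  assumes t: "t \<in> indices" and p: "p \<in> block t"
  shows "partner n t p \<in> levels - block t"
proof -
  obtain s x where t: "t = (s, x)" "x \<in> carrier R" using t by (auto simp: indices_def)
  show ?thesis
  proof (cases s)
    case True
    show ?thesis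
    proof (cases p)
      case None
      then show ?thesis using t True zero_notin_squares by (auto simp: levels_def r_neg minus_eq)
    next
      case (Some y)
      then have y: "y \<in> carrier R" "y \<ominus> x \<in> squares" using p t True by auto
      have nc: "n \<in> carrier R" using n by simp
      have "(x \<oplus> n \<otimes> (y \<ominus> x)) \<ominus> x = n \<otimes> (y \<ominus> x)" using y(1) t(2) nc by algebra
      then have "(x \<oplus> n \<otimes> (y \<ominus> x)) \<ominus> x \<notin> squares" using nonsquare_mult_square[OF n y(2)] by simp
      then show ?thesis using t True Some y n by (auto simp: levels_def)
    qed
  next
    case False
    then obtain y where y: "p = Some y" "y \<in> carrier R" "x \<ominus> y \<in> insert \<zero> squares" using p t by auto
    show ?thesis
    proof (cases "y = x")
      case True
      then show ?thesis using t False y by (auto simp: levels_def)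
    next
      case neq: False
      then have sq: "x \<ominus> y \<in> squares" using y t by (auto simp: r_right_minus_eq)
      have "x \<ominus> (x \<oplus> m \<otimes> (y \<ominus> x)) = m \<otimes> (x \<ominus> y)" if "m \<in> carrier R" for m
        using that y(2) t(2) by algebra
      then have "x \<ominus> (x \<oplus> inv n \<otimes> (y \<ominus> x)) \<notin> insert \<zero> squares"
        using nonsquare_mult_square[OF inverse_nonsquare(1,2) sq] inverse_nonsquare(1) by simp
      then show ?thesis using t False y neq inverse_nonsquare(1) by (auto simp: levels_def)
    qed
  qed
qed

lemma partner_inj_on_block:
  assumes t: "t \<in> indices"
  shows "inj_on (partner n t) (block t)"
proof (rule inj_onI)
  fix p q assume pq: "p \<in> block t" "q \<in> block t" "partner n t p = partner n t q"
  obtain s x where t: "t = (s, x)" "x \<in> carrier R" using t by (auto simp: indices_def)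
  show "p = q"
  proof (cases s)
    case True
    then have t: "t = (True, x)" "x \<in> carrier R" using t by simp_all
    have nc: "n \<in> carrier R" "n \<noteq> \<zero>" using n by auto
    have moved: "x \<oplus> n \<otimes> (y \<ominus> x) \<noteq> x" if y: "y \<in> carrier R" "y \<ominus> x \<in> squares" for y
    proof -
      have "y \<noteq> x" using y zero_notin_squares by (auto simp: minus_eq r_neg)
      then show ?thesis using homothety_fixed_iff[OF t(2) y(1) nc] by simp
    qed
    show ?thesis
    proof (cases p)
      case None
      then show ?thesis using pq moved[THEN not_sym] by (cases q) (auto simp: t(1))
    next
      case (Some y)
      then have y: "y \<in> carrier R" "y \<ominus> x \<in> squares" using pq(1) t(1) by auto
      show ?thesis
      proof (cases q)
        case None
        then show ?thesis using pq(3) moved[OF y] Some by (simp add: t(1))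
      next
        case q: (Some z)
        then have "z \<in> carrier R" using pq(2) t(1) by auto
        then show ?thesis
          using homothety_inj[OF t(2) y(1) _ nc] pq(3) Some q by (simp add: t(1))
      qed
    qed
  next
    case False
    then have t: "t = (False, x)" "x \<in> carrier R" using t by simp_all
    have nc: "inv n \<in> carrier R" "inv n \<noteq> \<zero>" using inverse_nonsquare(1) by auto
    obtain y z where y: "p = Some y" "y \<in> carrier R" and z: "q = Some z" "z \<in> carrier R"
      using pq(1,2) t(1) by auto
    show ?thesis
      using homothety_inj[OF t(2) y(2) z(2) nc] pq(3) y(1) z(1)
      by (simp add: t(1) split: if_splits)
  qed
qed

text \<open>
  An ordered pair of points cannot arise from two blocks. Within one family the centre can be
  recovered from a point and its image. If both families produced \<open>(y, z)\<close>, then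
  \<open>z - y = (n - 1) (y - x)\<close> and \<open>z - y = (1/n - 1) (y - x') = (n - 1) (x' - y) / n\<close>. Hence
  \<open>n (y - x) = x' - y\<close>, but the left side is a nonsquare and the right side a square.
\<close>

lemma partner_pairs_inj:
  "inj_on (\<lambda>(t, p). (p, partner n t p)) (SIGMA t:indices. block t)"
proof -
  note i = inverse_nonsquare
  have n1: "n \<noteq> \<one>" "inv n \<noteq> \<one>" using n i one_in_squares by auto
  have mixed: False
    if x: "x \<in> carrier R" "x' \<in> carrier R" "y \<in> carrier R"
      and sq: "y \<ominus> x \<in> squares" "x' \<ominus> y \<in> insert \<zero> squares"
      and eq: "x \<oplus> n \<otimes> (y \<ominus> x) = x' \<oplus> inv n \<otimes> (y \<ominus> x')" for x x' y
  proof -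
    let ?e = "n \<otimes> (y \<ominus> x)" and ?f = "x' \<ominus> y"
    have ef: "?e \<in> carrier R" "?f \<in> carrier R" using x n by auto
    have nc: "n \<in> carrier R" "inv n \<in> carrier R" using n i by auto
    have z: "a \<ominus> a = \<zero>" if "a \<in> carrier R" for a
      using that by (simp add: minus_eq r_neg)
    have "(n \<ominus> \<one>) \<otimes> (?e \<ominus> ?f)
        = n \<otimes> ((x \<oplus> n \<otimes> (y \<ominus> x)) \<ominus> (x' \<oplus> inv n \<otimes> (y \<ominus> x'))) \<oplus> (n \<otimes> inv n \<ominus> \<one>) \<otimes> (y \<ominus> x')"
      using x nc by algebra
    also have "\<dots> = \<zero>" unfolding eq i(3) using x nc by (simp add: z)
    finally have "?e \<ominus> ?f = \<zero>"
      using n1 nc ef by (auto simp: integral_iff r_right_minus_eq)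
    then have "?e = ?f" using ef by (simp add: r_right_minus_eq)
    then show False using nonsquare_mult_square[OF n sq(1)] sq(2) by simp
  qed
  have centre: "s = s' \<and> x = x'"
    if s: "p \<in> block (s, x)" "p \<in> block (s', x')" and x: "x \<in> carrier R" "x' \<in> carrier R"
      and eq: "partner n (s, x) p = partner n (s', x') p" for s s' x x' p
  proof (cases p)
    case None
    then show ?thesis using s eq by simp
  next
    case (Some y)
    then have y: "y \<in> carrier R" using s(1) by (cases s) auto
    have c: "x = x'" if "m \<in> carrier R" "m \<noteq> \<one>" "x \<oplus> m \<otimes> (y \<ominus> x) = x' \<oplus> m \<otimes> (y \<ominus> x')" for m
      using homothety_centre_inj[OF x y that] .
    show ?thesis
      using s eq Some x y n i n1 c[of n] c[of "inv n"] mixed[of x x' y] mixed[of x' x y]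
      by (cases s; cases s') (auto split: if_splits)
  qed
  show ?thesis
  proof (rule inj_onI)
    fix a b
    assume ab: "a \<in> (SIGMA t:indices. block t)" "b \<in> (SIGMA t:indices. block t)"
      and eq: "(\<lambda>(t, p). (p, partner n t p)) a = (\<lambda>(t, p). (p, partner n t p)) b"
    obtain s x p where a: "a = ((s, x), p)" by (metis prod.exhaust)
    obtain s' x' p' where b: "b = ((s', x'), p')" by (metis prod.exhaust)
    show "a = b"
      using ab eq centre[of p s x s' x'] unfolding a b indices_def by (auto simp del: block.simps partner.simps)
  qed
qed

end

end

section \<open>Plans from designs with matched complements\<close>

lemma bibd_complement:
  assumes bibd: "bibd V T D k r l" and V: "card V = 2 * k" and T: "card T = 2 * r"
  shows "bibd V T (\<lambda>t. V - D t) k r l"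
proof -
  have fin: "finite V" "finite T" and k: "2 \<le> k" "k < card V"
    and D: "\<And>t. t \<in> T \<Longrightarrow> D t \<subseteq> V" "\<And>t. t \<in> T \<Longrightarrow> card (D t) = k"
    and rep: "\<And>p. p \<in> V \<Longrightarrow> card {t \<in> T. p \<in> D t} = r"
    and pair: "\<And>p q. p \<in> V \<Longrightarrow> q \<in> V \<Longrightarrow> p \<noteq> q \<Longrightarrow> card {t \<in> T. p \<in> D t \<and> q \<in> D t} = l"
    using bibd by (auto simp: bibd_def)
  have size: "card (V - D t) = k" if "t \<in> T" for t
    using D[OF that] V fin by (subst card_Diff_subset) (auto intro: finite_subset)
  have rep': "card {t \<in> T. p \<in> V - D t} = r" if p: "p \<in> V" for p
  proof -
    have "{t \<in> T. p \<in> V - D t} = T - {t \<in> T. p \<in> D t}" using p by auto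
    then show ?thesis using rep[OF p] T fin by (simp add: card_Diff_subset)
  qed
  have pair': "card {t \<in> T. p \<in> V - D t \<and> q \<in> V - D t} = l"
    if pq: "p \<in> V" "q \<in> V" "p \<noteq> q" for p q
  proof -
    let ?P = "{t \<in> T. p \<in> D t}" and ?Q = "{t \<in> T. q \<in> D t}"
    have "{t \<in> T. p \<in> V - D t \<and> q \<in> V - D t} = T - (?P \<union> ?Q)" using pq by auto
    then have "card {t \<in> T. p \<in> V - D t \<and> q \<in> V - D t} = 2 * r - card (?P \<union> ?Q)"
      using T fin by (subst \<open>_ = T - _\<close>, subst card_Diff_subset) auto
    moreover have "card ?P + card ?Q = card (?P \<union> ?Q) + card (?P \<inter> ?Q)"
      using fin by (intro card_Un_Int) auto
    moreover have "?P \<inter> ?Q = {t \<in> T. p \<in> D t \<and> q \<in> D t}" by auto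
    moreover have "card (?P \<inter> ?Q) \<le> card ?P" using fin by (intro card_mono) auto
    ultimately show ?thesis using rep[OF pq(1)] rep[OF pq(2)] pair[OF pq] by simp
  qed
  show ?thesis
    unfolding bibd_def using fin k D size rep' pair' by auto
qed

lemma bibd_relabel:
  assumes bibd: "bibd V T D k r l" and f: "bij_betw f V V'" and g: "bij_betw g T T'"
  shows "bibd V' T' (\<lambda>s. f ` D (inv_into T g s)) k r l"
proof -
  let ?D = "\<lambda>s. f ` D (inv_into T g s)"
  have fin: "finite V" "finite T" and k: "2 \<le> k" "k < card V"
    and D: "\<And>t. t \<in> T \<Longrightarrow> D t \<subseteq> V" "\<And>t. t \<in> T \<Longrightarrow> card (D t) = k"
    and rep: "\<And>p. p \<in> V \<Longrightarrow> card {t \<in> T. p \<in> D t} = r"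
    and pair: "\<And>p q. p \<in> V \<Longrightarrow> q \<in> V \<Longrightarrow> p \<noteq> q \<Longrightarrow> card {t \<in> T. p \<in> D t \<and> q \<in> D t} = l"
    using bibd by (auto simp: bibd_def)
  have V': "V' = f ` V" and T': "T' = g ` T" and injf: "inj_on f V" and injg: "inj_on g T"
    using f g by (auto simp: bij_betw_def)
  have inv: "inv_into T g (g t) = t" if "t \<in> T" for t using that injg by simp
  have mem: "f p \<in> f ` D t \<longleftrightarrow> p \<in> D t" if "t \<in> T" "p \<in> V" for t p
    using inj_on_image_mem_iff[OF injf that(2) D(1)[OF that(1)]] .
  have memg: "f p \<in> ?D (g t) \<longleftrightarrow> p \<in> D t" if "p \<in> V" "t \<in> T" for t p
    using inv mem that by simp
  have count: "card {s \<in> T'. P s} = card {t \<in> T. P (g t)}" for P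
  proof -
    have "{s \<in> T'. P s} = g ` {t \<in> T. P (g t)}" using T' by auto
    moreover have "inj_on g {t \<in> T. P (g t)}" using injg by (rule inj_on_subset) auto
    ultimately show ?thesis by (simp add: card_image)
  qed
  have "card {s \<in> T'. f p \<in> ?D s} = r" if "p \<in> V" for p
  proof -
    have "{t \<in> T. f p \<in> ?D (g t)} = {t \<in> T. p \<in> D t}"
      using memg[OF that] by (intro Collect_cong conj_cong refl)
    then show ?thesis using rep[OF that] count by simp
  qed
  moreover have "card {s \<in> T'. f p \<in> ?D s \<and> f q \<in> ?D s} = l" if "p \<in> V" "q \<in> V" "p \<noteq> q" for p q
  proof -
    have "{t \<in> T. f p \<in> ?D (g t) \<and> f q \<in> ?D (g t)} = {t \<in> T. p \<in> D t \<and> q \<in> D t}"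
      using memg[OF that(1)] memg[OF that(2)] by (intro Collect_cong conj_cong refl)
    then show ?thesis using pair[OF that] count by simp
  qed
  moreover have "?D s \<subseteq> V' \<and> card (?D s) = k" if s: "s \<in> T'" for s
  proof -
    obtain t where t: "t \<in> T" "s = g t" using s T' by auto
    have "inj_on f (D t)" using injf D(1)[OF t(1)] by (rule inj_on_subset)
    then show ?thesis using t D inv V' by (auto simp: card_image)
  qed
  moreover have "card V' = card V" using V' injf by (simp add: card_image)
  ultimately show ?thesis
    unfolding bibd_def using fin k V' T' by auto
qed

lemma connected_of_bibd:
  assumes bibd: "bibd V T D k r l" and l: "l > 0" and N: "is_incidence_matrix V T D N"
  shows "connected_design V T N"
  unfolding connected_design_def
proof (intro ballI)
  fix p q assume p: "p \<in> V" and q: "q \<in> V"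
  show "(p, q) \<in> {(x, y). x \<in> V \<and> y \<in> V \<and> (\<exists>t\<in>T. N x t > 0 \<and> N y t > 0)}\<^sup>*"
  proof (cases "p = q")
    case False
    then have "card {t \<in> T. p \<in> D t \<and> q \<in> D t} > 0"
      using bibd p q l by (auto simp: bibd_def)
    then obtain t where "t \<in> T" "p \<in> D t" "q \<in> D t" by (auto simp: card_gt_0_iff)
    then show ?thesis
      using p q N by (intro r_into_rtrancl) (auto simp: is_incidence_matrix_def)
  qed simp
qed

text \<open>
  The runs are the pairs of a block \<open>t\<close> and a point \<open>p\<close> of it; the first factor is set to \<open>p\<close>, the
  second to \<open>\<sigma> t p\<close>. By cardinality, \<open>\<sigma> t\<close> maps \<open>D t\<close> onto its complement, and each ordered pair of
  different points is \<open>(p, \<sigma> t p)\<close> for exactly one run. So the two factors never agree and take every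
  other combination of levels once. On the other side, the number of blocks that contain \<open>p\<close> and
  whose complement contains \<open>q\<close> is \<open>0\<close> if \<open>p = q\<close>, and otherwise the replication number minus the
  pair count, \<open>(2 k - 1) - (k - 1) = k\<close>. This is orthogonality through the block factor.
\<close>

lemma balanced_potb_of_bibd_with_partners:
  fixes V :: "'p set" and T :: "'t set"
  assumes bibd: "bibd V T D k (2 * k - 1) (k - 1)" and V: "card V = 2 * k"
    and T: "card T = 2 * (2 * k - 1)"
    and outside: "\<And>t p. t \<in> T \<Longrightarrow> p \<in> D t \<Longrightarrow> \<sigma> t p \<in> V - D t"
    and inj: "\<And>t. t \<in> T \<Longrightarrow> inj_on (\<sigma> t) (D t)"
    and pairs: "inj_on (\<lambda>(t, p). (p, \<sigma> t p)) (SIGMA t:T. D t)"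
  shows "\<exists>S A. symmetric_experiment (2 * k) 2 S \<and> balanced_potb (2 * (2 * k - 1)) k 2 S A"
proof -
  define b where "b = 2 * (2 * k - 1)"
  have fin: "finite V" "finite T" and k: "2 \<le> k"
    and D: "\<And>t. t \<in> T \<Longrightarrow> D t \<subseteq> V" "\<And>t. t \<in> T \<Longrightarrow> card (D t) = k"
    and rep: "\<And>p. p \<in> V \<Longrightarrow> card {t \<in> T. p \<in> D t} = 2 * k - 1"
    and pair: "\<And>p q. p \<in> V \<Longrightarrow> q \<in> V \<Longrightarrow> p \<noteq> q \<Longrightarrow> card {t \<in> T. p \<in> D t \<and> q \<in> D t} = k - 1"
    using bibd by (auto simp: bibd_def)
  have finD: "finite (D t)" if "t \<in> T" for t using D(1)[OF that] fin finite_subset by blast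
  have DV: "p \<in> V" if "t \<in> T" "p \<in> D t" for t p using D(1) that by blast
  define \<Omega> where "\<Omega> = (SIGMA t:T. D t)"
  have \<Omega>_iff: "(t, p) \<in> \<Omega> \<longleftrightarrow> t \<in> T \<and> p \<in> D t \<and> p \<in> V \<and> \<sigma> t p \<in> V \<and> \<sigma> t p \<notin> D t" for t p
    using outside D(1) by (auto simp: \<Omega>_def)
  have fin\<Omega>: "finite \<Omega>" using fin finD by (simp add: \<Omega>_def)
  have card\<Omega>: "card \<Omega> = b * k" using D T fin finD by (simp add: \<Omega>_def b_def)
  obtain e where e: "bij_betw e {..<b * k} \<Omega>"
    using ex_bij_betw_nat_finite[OF fin\<Omega>] card\<Omega> by (auto simp: atLeast0LessThan)
  obtain g where g: "bij_betw g T {1..b}"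
    using ex_bij_betw_finite_nat[OF fin(2)] finite_same_card_bij[of T "{1..b}"] fin T
    by (auto simp: b_def)
  obtain f where f: "bij_betw f V {..<2 * k}"
    using finite_same_card_bij[of V "{..<2 * k}"] fin V by auto
  define S :: "nat \<Rightarrow> nat set" where "S = (\<lambda>i. {..<2 * k})"
  define A :: "nat \<Rightarrow> nat \<Rightarrow> nat" where
    "A i c = (case e c of (t, p) \<Rightarrow> if i = 0 then g t else if i = 1 then f p else f (\<sigma> t p))" for i c
  have SV: "S i = f ` V" for i using f by (simp add: S_def bij_betw_def)
  have Bg: "{1..b} = g ` T" using g by (simp add: bij_betw_def)
  have injf: "f p = f q \<longleftrightarrow> p = q" if "p \<in> V" "q \<in> V" for p q
    using that f by (auto simp: bij_betw_def inj_on_def)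
  have injg: "g t = g u \<longleftrightarrow> t = u" if "t \<in> T" "u \<in> T" for t u
    using that g by (auto simp: bij_betw_def inj_on_def)
  have run: "e c \<in> \<Omega>" if "c < b * k" for c using that e by (auto simp: bij_betw_def)
  have count: "card {c \<in> {..<b * k}. P (e c)} = card {w \<in> \<Omega>. P w}" for P
  proof -
    have "{w \<in> \<Omega>. P w} = e ` {c \<in> {..<b * k}. P (e c)}" using e by (auto simp: bij_betw_def)
    moreover have "inj_on e {c \<in> {..<b * k}. P (e c)}" using e by (auto simp: bij_betw_def inj_on_def)
    ultimately show ?thesis by (simp add: card_image)
  qed
  \<comment> \<open>Injective maps between finite sets of equal size are onto, here and in \<open>allpairs\<close>.\<close>
  have onto: "\<sigma> t ` D t = V - D t" if t: "t \<in> T" for t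
  proof (rule card_subset_eq)
    show "finite (V - D t)" using fin by simp
    show "\<sigma> t ` D t \<subseteq> V - D t" using outside[OF t] by auto
    show "card (\<sigma> t ` D t) = card (V - D t)"
      using card_image[OF inj[OF t]] D[OF t] V finD[OF t] by (simp add: card_Diff_subset)
  qed
  have cooc10: "cooc (b * k) A 1 0 (f p) (g t) = (if p \<in> D t then 1 else 0)" if p: "p \<in> V" and t: "t \<in> T" for p t
  proof -
    have "cooc (b * k) A 1 0 (f p) (g t) = card {w \<in> \<Omega>. f (snd w) = f p \<and> g (fst w) = g t}"
      unfolding cooc_def count[symmetric] by (simp add: A_def case_prod_beta)
    also have "{w \<in> \<Omega>. f (snd w) = f p \<and> g (fst w) = g t} = (if p \<in> D t then {(t, p)} else {})"
      using p t injf injg outside by (auto simp: \<Omega>_iff)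
    finally show ?thesis by simp
  qed
  have cooc20: "cooc (b * k) A 2 0 (f q) (g t) = (if q \<in> V - D t then 1 else 0)" if q: "q \<in> V" and t: "t \<in> T" for q t
  proof -
    have "cooc (b * k) A 2 0 (f q) (g t) = card {w \<in> \<Omega>. f (\<sigma> (fst w) (snd w)) = f q \<and> g (fst w) = g t}"
      unfolding cooc_def count[symmetric] by (simp add: A_def case_prod_beta)
    also have "{w \<in> \<Omega>. f (\<sigma> (fst w) (snd w)) = f q \<and> g (fst w) = g t} = Pair t ` {p \<in> D t. \<sigma> t p = q}"
      using q t injf injg outside DV by (auto simp: \<Omega>_iff)
    also have "card \<dots> = card {p \<in> D t. \<sigma> t p = q}" by (simp add: card_image inj_on_def)
    also have "\<dots> = (if q \<in> V - D t then 1 else 0)"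
    proof (cases "q \<in> V - D t")
      case True
      then obtain p where p: "p \<in> D t" "\<sigma> t p = q" using onto[OF t] by (metis imageE)
      then have "{p \<in> D t. \<sigma> t p = q} = {p}" using inj[OF t] by (auto simp: inj_on_def)
      then show ?thesis using True by simp
    next
      case False
      then have none: "{p \<in> D t. \<sigma> t p = q} = {}" using onto[OF t] by auto
      show ?thesis unfolding none using False by simp
    qed
    finally show ?thesis .
  qed
  have allpairs: "(\<lambda>(t, p). (p, \<sigma> t p)) ` \<Omega> = V \<times> V - Id_on V"
  proof (rule card_subset_eq)
    show "finite (V \<times> V - Id_on V)" using fin by simp
    show "(\<lambda>(t, p). (p, \<sigma> t p)) ` \<Omega> \<subseteq> V \<times> V - Id_on V"
      by (auto simp: \<Omega>_iff)
    have "Id_on V = (\<lambda>p. (p, p)) ` V" by auto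
    then have "card (Id_on V) = 2 * k" "finite (Id_on V)" using V fin by (auto simp: card_image inj_on_def)
    then have "card (V \<times> V - Id_on V) = 2 * k * (2 * k) - 2 * k"
      using V by (subst card_Diff_subset) (auto simp: card_cartesian_product)
    also have "\<dots> = b * k" by (simp add: b_def algebra_simps)
    finally show "card ((\<lambda>(t, p). (p, \<sigma> t p)) ` \<Omega>) = card (V \<times> V - Id_on V)"
      using card_image[OF pairs] card\<Omega> by (simp add: \<Omega>_def)
  qed
  have cooc12: "cooc (b * k) A 1 2 (f p) (f q) = (if p = q then 0 else 1)" if p: "p \<in> V" and q: "q \<in> V" for p q
  proof -
    let ?W = "{w \<in> \<Omega>. (\<lambda>(t, p). (p, \<sigma> t p)) w = (p, q)}"
    have "cooc (b * k) A 1 2 (f p) (f q) = card {w \<in> \<Omega>. f (snd w) = f p \<and> f (\<sigma> (fst w) (snd w)) = f q}"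
      unfolding cooc_def count[symmetric] by (simp add: A_def case_prod_beta)
    also have "{w \<in> \<Omega>. f (snd w) = f p \<and> f (\<sigma> (fst w) (snd w)) = f q} = ?W"
      using p q injf by (auto simp: \<Omega>_iff)
    also have "card ?W = (if p = q then 0 else 1)"
    proof (cases "p = q")
      case True
      then have "(p, q) \<notin> (\<lambda>(t, p). (p, \<sigma> t p)) ` \<Omega>" unfolding allpairs using p by auto
      then have none: "?W = {}" by force
      show ?thesis unfolding none using True by simp
    next
      case False
      then have "(p, q) \<in> (\<lambda>(t, p). (p, \<sigma> t p)) ` \<Omega>" unfolding allpairs using p q by auto
      then obtain w where w: "w \<in> \<Omega>" "(\<lambda>(t, p). (p, \<sigma> t p)) w = (p, q)" by (elim imageE) simp
      have "u = w" if "u \<in> ?W" for u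
        using that w by (intro inj_onD[OF pairs]) (simp_all add: \<Omega>_def)
      then have single: "?W = {w}" using w by blast
      show ?thesis unfolding single using False by simp
    qed
    finally show ?thesis .
  qed
  have cooc21: "cooc (b * k) A 2 1 x y = cooc (b * k) A 1 2 y x" for x y
    by (simp add: cooc_def conj_commute)
  have orth: "(\<Sum>s\<in>{1..b}. cooc (b * k) A 1 0 (f p) s * cooc (b * k) A 2 0 (f q) s) = k * (if p = q then 0 else 1)"
    if p: "p \<in> V" and q: "q \<in> V" for p q
  proof -
    have "(\<Sum>s\<in>{1..b}. cooc (b * k) A 1 0 (f p) s * cooc (b * k) A 2 0 (f q) s)
        = (\<Sum>t\<in>T. cooc (b * k) A 1 0 (f p) (g t) * cooc (b * k) A 2 0 (f q) (g t))"
      using g by (rule sum.reindex_bij_betw[symmetric])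
    also have "\<dots> = (\<Sum>t\<in>T. if p \<in> D t \<and> q \<notin> D t then 1 else 0)"
      using cooc10[OF p] cooc20[OF q] q by (intro sum.cong) auto
    also have "\<dots> = card {t \<in> T. p \<in> D t \<and> q \<notin> D t}"
      using fin by (simp add: sum.If_cases Int_def)
    also have "\<dots> = k * (if p = q then 0 else 1)"
    proof (cases "p = q")
      case False
      have "{t \<in> T. p \<in> D t \<and> q \<notin> D t} = {t \<in> T. p \<in> D t} - {t \<in> T. p \<in> D t \<and> q \<in> D t}" by auto
      then have "card {t \<in> T. p \<in> D t \<and> q \<notin> D t} = (2 * k - 1) - (k - 1)"
        using rep[OF p] pair[OF p q False] fin by (simp only:) (subst card_Diff_subset, auto)
      then show ?thesis using False k by simp
    qed simp
    finally show ?thesis .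
  qed
  have block_size: "card {c \<in> {..<b * k}. A 0 c = g t} = k" if t: "t \<in> T" for t
  proof -
    have "card {c \<in> {..<b * k}. A 0 c = g t} = card {w \<in> \<Omega>. g (fst w) = g t}"
      unfolding count[symmetric] by (simp add: A_def case_prod_beta)
    also have "{w \<in> \<Omega>. g (fst w) = g t} = Pair t ` D t" using t injg DV outside by (auto simp: \<Omega>_iff)
    finally show ?thesis using D(2)[OF t] by (simp add: card_image inj_on_def)
  qed
  have mep: "blocked_mep b k 2 S A"
    unfolding blocked_mep_def
  proof (intro conjI ballI allI impI)
    show "b \<ge> 1" "k \<ge> 1" "(2::nat) \<ge> 1" using k by (auto simp: b_def)
    fix c assume "c < b * k"
    then show "A 0 c \<in> {1..b}" using run[of c] unfolding Bg by (auto simp: A_def \<Omega>_iff split: prod.splits)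
  next
    fix j assume "j \<in> {1..b}"
    then show "card {c \<in> {..<b * k}. A 0 c = j} = k" using block_size unfolding Bg by auto
  next
    fix i c assume "i \<in> {1..2::nat}" "c < b * k"
    then show "A i c \<in> S i" using run[of c] unfolding SV by (auto simp: A_def \<Omega>_iff split: prod.splits)
  qed (simp add: S_def)
  have two: "{1..2} = {1, 2::nat}" by auto
  have potb: "potb b k 2 S A"
    unfolding potb_def two orthogonal_through_block_def
    using mep orth cooc12 cooc21 by (auto simp: SV mult.commute)
  have inv: "inv_into T g (g t) = t" if "t \<in> T" for t using that g by (simp add: bij_betw_def)
  let ?D1 = "\<lambda>s. f ` D (inv_into T g s)" and ?D2 = "\<lambda>s. f ` (V - D (inv_into T g s))"
  have bibd1: "bibd (S 1) {1..b} ?D1 k (2 * k - 1) (k - 1)"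
    using bibd_relabel[OF bibd f g] by (simp add: S_def)
  have bibd2: "bibd (S 2) {1..b} ?D2 k (2 * k - 1) (k - 1)"
    using bibd_relabel[OF bibd_complement[OF bibd V T] f g] by (simp add: S_def)
  have memf: "f p \<in> f ` E \<longleftrightarrow> p \<in> E" if "p \<in> V" "E \<subseteq> V" for p E
    using that injf by (auto simp: image_iff subset_eq)
  have inc1: "is_incidence_matrix (S 1) {1..b} ?D1 (cooc (b * k) A 1 0)"
    unfolding is_incidence_matrix_def SV Bg using inv memf cooc10 D(1) by auto
  have inc2: "is_incidence_matrix (S 2) {1..b} ?D2 (cooc (b * k) A 2 0)"
    unfolding is_incidence_matrix_def SV Bg using inv memf cooc20 by auto
  have conn: "connected_mep b k 2 S A"
    unfolding connected_mep_def two
    using mep connected_of_bibd[OF bibd1 _ inc1] connected_of_bibd[OF bibd2 _ inc2] k by auto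
  have "balanced_potb b k 2 S A"
    unfolding balanced_potb_def two using potb conn bibd1 bibd2 inc1 inc2 by blast
  moreover have "symmetric_experiment (2 * k) 2 S"
    by (simp add: symmetric_experiment_def S_def)
  ultimately show ?thesis unfolding b_def by blast
qed

section \<open>Existence of the plan\<close>

theorem theorem3p4:
  fixes v :: nat
  assumes "primepow v" and "odd v"
  shows "\<exists>S A. symmetric_experiment (v + 1) 2 S \<and>
                balanced_potb (2 * v) ((v + 1) div 2) 2 S A"
proof -
  obtain F :: "((int list \<times> nat) multiset \<Rightarrow> int) ring"
    where F: "field F" "finite (carrier F)" and v: "card (carrier F) = v"
    using finite_field_of_prime_power_order[OF assms(1)] .
  interpret F: field F by (rule F(1))
  interpret F: odd_finite_field F by unfold_locales (use F v assms in auto)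
  obtain n where n: "n \<in> carrier F - {\<zero>\<^bsub>F\<^esub>}" "n \<notin> F.squares"
    using F.nonsquare_exists by blast
  define k where "k = Suc (card F.squares)"
  have vk: "v = 2 * k - 1" "v + 1 = 2 * k" "(v + 1) div 2 = k"
    using F.card_squares v by (auto simp: k_def)
  have "\<exists>S A. symmetric_experiment (2 * k) 2 S \<and> balanced_potb (2 * (2 * k - 1)) k 2 S A"
  proof (rule balanced_potb_of_bibd_with_partners)
    show "bibd F.levels F.indices F.block k (2 * k - 1) (k - 1)"
      using F.bibd_block v vk(1) by (simp add: k_def)
    show "card F.levels = 2 * k" using F.card_levels by (simp add: k_def)
    show "card F.indices = 2 * (2 * k - 1)" using F.card_indices v vk(1) by simp
  qed (rule F.partner_outside_block[OF n] F.partner_inj_on_block[OF n] F.partner_pairs_inj[OF n];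
      assumption?)+
  then show ?thesis unfolding vk(3) unfolding vk(2) vk(1)[symmetric] .
qed

end
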